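(* Let $X$ be a quasi-Polish space and let $\mathcal M$ be a second-countable étale structure (in some countable, possibly multi-sorted, first-order language) over $X$. Then there exist a countable single-sorted (relational) language $\mathcal L$ (not necessarily that of $\mathcal M$) and a full and faithful Borel functor $\mathrm{Iso}_X(\mathcal M)\to\mathbb S_\infty\ltimes\mathrm{Mod}_{\mathbb N}(\mathcal L)$.
   Context: Quasi-Polish spaces. Let $\mathbb S=\{0,1\}$ with open sets $\emptyset,\{1\},\{0,1\}$. A set is $\mathbf\Pi^0_2$ if it is of the form $\bigcap_{i\in\mathbb N}(F_i\cup U_i)$ with $F_i$ closed, $U_i$ open. A space is quasi-Polish if it is homeomorphic to a $\mathbf\Pi^0_2$ subspace of $\mathbb S^{\mathbb N}$. Quasi-Polish spaces are standard Borel with respect to their Borel $\sigma$-algebras. Étale spaces and structures. For maps $p:A\to X$, $q:B\to X$: $A_x=p^{-1}(x)$, $A\times_XB=\{(a,b):p(a)=q(b)\}$ with the subspace topology; a map $f:A\to B$ is over $X$ if $q\circ f=p$. The empty fiber product is $X$. An étale space over $X$ is a topological space $A$ with a continuous $p:A\to X$ such that $A$ is covered by open sections, i.e., open $S\subseteq A$ for which $p|S:S\to X$ is an open embedding. For a multi-sorted first-order language $\mathcal L_0$, an étale $\mathcal L_0$-structure $\mathcal M$ over $X$ consists of an étale space $P^{\mathcal M}$ over $X$ for each sort $P$; an open $R^{\mathcal M}\subseteq P_0^{\mathcal M}\times_X\cdots\times_XP_{n-1}^{\mathcal M}$ for each $(P_0,\dots,P_{n-1})$-ary relation symbol $R$;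 and a continuous map $f^{\mathcal M}:P_0^{\mathcal M}\times_X\cdots\times_XP_{n-1}^{\mathcal M}\to Q^{\mathcal M}$ over $X$ for each $(P_0,\dots,P_{n-1})$-ary $Q$-valued function symbol $f$. The fibers over $x$ form an $\mathcal L_0$-structure $\mathcal M_x$. $\mathcal M$ is second-countable if $\mathcal L_0$ is countable and $X$ and all $P^{\mathcal M}$ are second-countable. Isomorphism groupoid. $\mathrm{Iso}_X(\mathcal M)$ has objects $X$, and morphisms $x\to y$ are triples $(x,y,f)$ with $f=(f_P)_P$ an isomorphism $\mathcal M_x\cong\mathcal M_y$; its set of morphisms has the topology generated by continuity of source and target together with the sets $\{(x,y,f):f_P(S_x)\cap T_y\ne\emptyset\}$ for sorts $P$ and open $S,T\subseteq P^{\mathcal M}$ ($S_x=S\cap P_x^{\mathcal M}$). For $X$ quasi-Polish and $\mathcal M$ second-countable this is a quasi-Polish groupoid, regarded as a standard Borel groupoid. Structures on $\mathbb N$. For a countable single-sorted relational $\mathcal L$, $\mathrm{Mod}_{\mathbb N}(\mathcal L)=\prod_{R\in\mathcal L}2^{\mathbb N^{n_R}}$ ($n_R$ the arity of $R$) is the Polish space of $\mathcal L$-structures on $\mathbb N$; $\mathbb S_\infty$, the Polish group of bijections of $\mathbb N$, acts on it by pushforward of structures. The action groupoid $\mathbb S_\infty\ltimes\mathrm{Mod}_{\mathbb N}(\mathcal L)$ has objects $\mathrm{Mod}_{\mathbb N}(\mathcal L)$ and morphisms $(g,\mathcal N):\mathcal N\to g\cdot\mathcal N$. A Borel functor between standard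 Borel groupoids is a functor that is Borel on objects and on morphisms; a functor $F:G\to H$ is full (faithful) if each map $G(x,y)\to H(F(x),F(y))$ on hom-sets is surjective (injective). *)

theory Defs
  imports "HOL-Analysis.Analysis"
begin

section \<open>Quasi-Polish spaces\<close>

definition sierpinski :: "bool topology" where
  "sierpinski = topology (\<lambda>U. U \<in> {{}, {True}, UNIV})"

lemma openin_sierpinski: "openin sierpinski U \<longleftrightarrow> U \<in> {{}, {True}, UNIV}"
proof -
  have *: "U \<in> {{}, {True}, UNIV} \<longleftrightarrow> (False \<in> U \<longrightarrow> True \<in> U)" for U :: "bool set"
  proof -
    have "U \<in> {{}, {True}, {False}, {True, False}}"
      by (cases "True \<in> U"; cases "False \<in> U") (auto, (metis (full_types))+)
    then show ?thesis by (auto simp: UNIV_bool)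
  qed
  have "istopology (\<lambda>U :: bool set. U \<in> {{}, {True}, UNIV})"
    unfolding istopology_def * by blast
  then show ?thesis
    by (simp add: sierpinski_def)
qed

definition pi02_in :: "'a topology \<Rightarrow> 'a set \<Rightarrow> bool" where
  "pi02_in X A \<longleftrightarrow> (\<exists>F U. (\<forall>i::nat. closedin X (F i) \<and> openin X (U i)) \<and> A = (\<Inter>i. F i \<union> U i))"

definition quasi_polish :: "'a topology \<Rightarrow> bool" where
  "quasi_polish X \<longleftrightarrow>
     (\<exists>A. pi02_in (product_topology (\<lambda>_::nat. sierpinski) UNIV) A \<and>
          X homeomorphic_space subtopology (product_topology (\<lambda>_::nat. sierpinski) UNIV) A)"

definition borel_of :: "'a topology \<Rightarrow> 'a measure" where
  "borel_of X = sigma (topspace X) {U. openin X U}"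


section \<open>Multi-sorted languages and structures\<close>

record ('s, 'r, 'f) language =
  sorts :: "'s set"
  rels :: "'r set"
  rel_arity :: "'r \<Rightarrow> 's list"
  funs :: "'f set"
  fun_arity :: "'f \<Rightarrow> 's list"
  fun_sort :: "'f \<Rightarrow> 's"

definition language :: "('s, 'r, 'f) language \<Rightarrow> bool" where
  "language L \<longleftrightarrow>
     (\<forall>R\<in>rels L. set (rel_arity L R) \<subseteq> sorts L) \<and>
     (\<forall>f\<in>funs L. set (fun_arity L f) \<subseteq> sorts L \<and> fun_sort L f \<in> sorts L)"

definition countable_language :: "('s, 'r, 'f) language \<Rightarrow> bool" where
  "countable_language L \<longleftrightarrow> countable (sorts L) \<and> countable (rels L) \<and> countable (funs L)"

text \<open>
  An \<open>n\<close>-tuple is an extensional function on \<open>{..<n}\<close>.  The carriers of all sorts are sets in one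
  type \<open>'a\<close>; carriers of different sorts need not be disjoint.
\<close>

record ('s, 'r, 'f, 'a) fo_structure =
  carr :: "'s \<Rightarrow> 'a set"
  rel :: "'r \<Rightarrow> (nat \<Rightarrow> 'a) set"
  op :: "'f \<Rightarrow> (nat \<Rightarrow> 'a) \<Rightarrow> 'a"

definition tuples :: "('s, 'r, 'f, 'a) fo_structure \<Rightarrow> 's list \<Rightarrow> (nat \<Rightarrow> 'a) set" where
  "tuples A w = (\<Pi>\<^sub>E i\<in>{..<length w}. carr A (w ! i))"

definition map_tuple :: "('s \<Rightarrow> 'a \<Rightarrow> 'b) \<Rightarrow> 's list \<Rightarrow> (nat \<Rightarrow> 'a) \<Rightarrow> nat \<Rightarrow> 'b" where
  "map_tuple h w a = (\<lambda>i\<in>{..<length w}. h (w ! i) (a i))"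

definition structure_iso ::
  "('s, 'r, 'f) language \<Rightarrow> ('s, 'r, 'f, 'a) fo_structure \<Rightarrow> ('s, 'r, 'f, 'b) fo_structure
    \<Rightarrow> ('s \<Rightarrow> 'a \<Rightarrow> 'b) \<Rightarrow> bool" where
  "structure_iso L A B h \<longleftrightarrow>
     (\<forall>P\<in>sorts L. bij_betw (h P) (carr A P) (carr B P)) \<and>
     (\<forall>R\<in>rels L. \<forall>a\<in>tuples A (rel_arity L R).
        a \<in> rel A R \<longleftrightarrow> map_tuple h (rel_arity L R) a \<in> rel B R) \<and>
     (\<forall>f\<in>funs L. \<forall>a\<in>tuples A (fun_arity L f).
        h (fun_sort L f) (op A f a) = op B f (map_tuple h (fun_arity L f) a))"


section \<open>Etale spaces and structures\<close>

definition open_section :: "'x topology \<Rightarrow> 'a topology \<Rightarrow> ('a \<Rightarrow> 'x) \<Rightarrow> 'a set \<Rightarrow> bool" where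
  "open_section X A p S \<longleftrightarrow>
     openin A S \<and> embedding_map (subtopology A S) X p \<and> open_map (subtopology A S) X p"

definition etale_space :: "'x topology \<Rightarrow> 'a topology \<Rightarrow> ('a \<Rightarrow> 'x) \<Rightarrow> bool" where
  "etale_space X A p \<longleftrightarrow>
     continuous_map A X p \<and> topspace A = \<Union>{S. open_section X A p S}"

record ('s, 'r, 'f, 'x, 'a) etale_data =
  space_of :: "'s \<Rightarrow> 'a topology"
  proj :: "'s \<Rightarrow> 'a \<Rightarrow> 'x"
  erel :: "'r \<Rightarrow> ('x \<times> (nat \<Rightarrow> 'a)) set"
  eop :: "'f \<Rightarrow> 'x \<times> (nat \<Rightarrow> 'a) \<Rightarrow> 'a"

text \<open>
  Points of the fiber product of \<open>P\<^sub>0, \<dots>, P\<^sub>n\<^sub>-\<^sub>1\<close> are represented as \<open>(x, a)\<close> where \<open>a\<close> is an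
  \<open>n\<close>-tuple in the fibers over \<open>x\<close>.  For \<open>n > 0\<close> the base point \<open>x\<close> is a continuous function of \<open>a\<close>,
  so forgetting it is a homeomorphism onto the usual subspace of the product of the \<open>P\<^sub>i\<close>; for \<open>n = 0\<close>
  the space is (a copy of) \<open>X\<close>.
\<close>

definition fiber_product ::
  "'x topology \<Rightarrow> ('s, 'r, 'f, 'x, 'a) etale_data \<Rightarrow> 's list \<Rightarrow> ('x \<times> (nat \<Rightarrow> 'a)) topology" where
  "fiber_product X M w =
     subtopology (prod_topology X (product_topology (\<lambda>i. space_of M (w ! i)) {..<length w}))
       {(x, a). \<forall>i<length w. proj M (w ! i) (a i) = x}"

definition etale_structure ::
  "('s, 'r, 'f) language \<Rightarrow> 'x topology \<Rightarrow> ('s, 'r, 'f, 'x, 'a) etale_data \<Rightarrow> bool" where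
  "etale_structure L X M \<longleftrightarrow>
     language L \<and>
     (\<forall>P\<in>sorts L. etale_space X (space_of M P) (proj M P)) \<and>
     (\<forall>R\<in>rels L. openin (fiber_product X M (rel_arity L R)) (erel M R)) \<and>
     (\<forall>f\<in>funs L.
        continuous_map (fiber_product X M (fun_arity L f)) (space_of M (fun_sort L f)) (eop M f) \<and>
        (\<forall>(x, a)\<in>topspace (fiber_product X M (fun_arity L f)).
           proj M (fun_sort L f) (eop M f (x, a)) = x))"

definition second_countable_structure ::
  "('s, 'r, 'f) language \<Rightarrow> 'x topology \<Rightarrow> ('s, 'r, 'f, 'x, 'a) etale_data \<Rightarrow> bool" where
  "second_countable_structure L X M \<longleftrightarrow>
     countable_language L \<and> second_countable X \<and> (\<forall>P\<in>sorts L. second_countable (space_of M P))"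

definition fiber :: "('s, 'r, 'f, 'x, 'a) etale_data \<Rightarrow> 'x \<Rightarrow> ('s, 'r, 'f, 'a) fo_structure" where
  "fiber M x =
     \<lparr>carr = (\<lambda>P. {a \<in> topspace (space_of M P). proj M P a = x}),
      rel = (\<lambda>R. {a. (x, a) \<in> erel M R}),
      op = (\<lambda>f a. eop M f (x, a))\<rparr>"


section \<open>Topological groupoids and Borel functors\<close>

record ('o, 'm) top_groupoid =
  Obj :: "'o topology"
  Mor :: "'m topology"
  src :: "'m \<Rightarrow> 'o"
  tgt :: "'m \<Rightarrow> 'o"
  ident :: "'o \<Rightarrow> 'm"
  mcomp :: "'m \<Rightarrow> 'm \<Rightarrow> 'm" \<comment> \<open>\<open>mcomp G g f\<close> is \<open>g\<close> after \<open>f\<close>\<close>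

abbreviation objects :: "('o, 'm) top_groupoid \<Rightarrow> 'o set" where
  "objects G \<equiv> topspace (Obj G)"

abbreviation arrows :: "('o, 'm) top_groupoid \<Rightarrow> 'm set" where
  "arrows G \<equiv> topspace (Mor G)"

definition hom_set :: "('o, 'm) top_groupoid \<Rightarrow> 'o \<Rightarrow> 'o \<Rightarrow> 'm set" where
  "hom_set G x y = {f \<in> arrows G. src G f = x \<and> tgt G f = y}"

definition is_groupoid :: "('o, 'm) top_groupoid \<Rightarrow> bool" where
  "is_groupoid G \<longleftrightarrow>
     (\<forall>f\<in>arrows G. src G f \<in> objects G \<and> tgt G f \<in> objects G) \<and>
     (\<forall>x\<in>objects G. ident G x \<in> hom_set G x x) \<and>
     (\<forall>x y z. \<forall>f\<in>hom_set G x y. \<forall>g\<in>hom_set G y z. mcomp G g f \<in> hom_set G x z) \<and>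
     (\<forall>x y. \<forall>f\<in>hom_set G x y. mcomp G f (ident G x) = f \<and> mcomp G (ident G y) f = f) \<and>
     (\<forall>x y z w. \<forall>f\<in>hom_set G x y. \<forall>g\<in>hom_set G y z. \<forall>h\<in>hom_set G z w.
        mcomp G h (mcomp G g f) = mcomp G (mcomp G h g) f) \<and>
     (\<forall>x y. \<forall>f\<in>hom_set G x y. \<exists>g\<in>hom_set G y x. mcomp G g f = ident G x \<and> mcomp G f g = ident G y)"

definition borel_functor ::
  "('o, 'm) top_groupoid \<Rightarrow> ('p, 'n) top_groupoid \<Rightarrow> ('o \<Rightarrow> 'p) \<Rightarrow> ('m \<Rightarrow> 'n) \<Rightarrow> bool" where
  "borel_functor G H F0 F1 \<longleftrightarrow>
     F0 \<in> measurable (borel_of (Obj G)) (borel_of (Obj H)) \<and>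
     F1 \<in> measurable (borel_of (Mor G)) (borel_of (Mor H)) \<and>
     (\<forall>f\<in>arrows G. src H (F1 f) = F0 (src G f) \<and> tgt H (F1 f) = F0 (tgt G f)) \<and>
     (\<forall>x\<in>objects G. F1 (ident G x) = ident H (F0 x)) \<and>
     (\<forall>f\<in>arrows G. \<forall>g\<in>arrows G. src G g = tgt G f \<longrightarrow>
        F1 (mcomp G g f) = mcomp H (F1 g) (F1 f))"

definition full_functor ::
  "('o, 'm) top_groupoid \<Rightarrow> ('p, 'n) top_groupoid \<Rightarrow> ('o \<Rightarrow> 'p) \<Rightarrow> ('m \<Rightarrow> 'n) \<Rightarrow> bool" where
  "full_functor G H F0 F1 \<longleftrightarrow>
     (\<forall>x\<in>objects G. \<forall>y\<in>objects G. F1 ` hom_set G x y = hom_set H (F0 x) (F0 y))"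

definition faithful_functor ::
  "('o, 'm) top_groupoid \<Rightarrow> ('p, 'n) top_groupoid \<Rightarrow> ('o \<Rightarrow> 'p) \<Rightarrow> ('m \<Rightarrow> 'n) \<Rightarrow> bool" where
  "faithful_functor G H F0 F1 \<longleftrightarrow>
     (\<forall>x\<in>objects G. \<forall>y\<in>objects G. inj_on F1 (hom_set G x y))"


section \<open>The isomorphism groupoid\<close>

text \<open>
  A family \<open>h = (h\<^sub>P)\<^sub>P\<close> is normalised to be \<^const>\<open>undefined\<close> outside the set of sorts and each \<open>h\<^sub>P\<close> to
  be \<^const>\<open>undefined\<close> outside the fiber over the source, so that equality of triples is equality of
  families of maps.
\<close>

definition iso_morphisms ::
  "('s, 'r, 'f) language \<Rightarrow> 'x topology \<Rightarrow> ('s, 'r, 'f, 'x, 'a) etale_data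
    \<Rightarrow> ('x \<times> 'x \<times> ('s \<Rightarrow> 'a \<Rightarrow> 'a)) set" where
  "iso_morphisms L X M =
     {(x, y, h). x \<in> topspace X \<and> y \<in> topspace X \<and>
        h \<in> (\<Pi>\<^sub>E P\<in>sorts L. extensional (carr (fiber M x) P)) \<and>
        structure_iso L (fiber M x) (fiber M y) h}"

definition iso_topology ::
  "('s, 'r, 'f) language \<Rightarrow> 'x topology \<Rightarrow> ('s, 'r, 'f, 'x, 'a) etale_data
    \<Rightarrow> ('x \<times> 'x \<times> ('s \<Rightarrow> 'a \<Rightarrow> 'a)) topology" where
  "iso_topology L X M =
     topology_generated_by
       ({{(x, y, h) \<in> iso_morphisms L X M. x \<in> U} |U. openin X U} \<union>
        {{(x, y, h) \<in> iso_morphisms L X M. y \<in> U} |U. openin X U} \<union>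
        {{(x, y, h) \<in> iso_morphisms L X M.
            h P ` (S \<inter> carr (fiber M x) P) \<inter> (T \<inter> carr (fiber M y) P) \<noteq> {}} |P S T.
          P \<in> sorts L \<and> openin (space_of M P) S \<and> openin (space_of M P) T})"

definition iso_groupoid ::
  "('s, 'r, 'f) language \<Rightarrow> 'x topology \<Rightarrow> ('s, 'r, 'f, 'x, 'a) etale_data
    \<Rightarrow> ('x, 'x \<times> 'x \<times> ('s \<Rightarrow> 'a \<Rightarrow> 'a)) top_groupoid" where
  "iso_groupoid L X M =
     \<lparr>Obj = X,
      Mor = iso_topology L X M,
      src = (\<lambda>(x, y, h). x),
      tgt = (\<lambda>(x, y, h). y),
      ident = (\<lambda>x. (x, x, \<lambda>P\<in>sorts L. \<lambda>a\<in>carr (fiber M x) P. a)),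
      mcomp = (\<lambda>(y', z, k) (x, y, h).
        (x, z, \<lambda>P\<in>sorts L. \<lambda>a\<in>carr (fiber M x) P. k P (h P a)))\<rparr>"


section \<open>Structures on the natural numbers\<close>

text \<open>
  A single-sorted relational language is given by its set \<open>L\<close> of relation symbols and the function
  \<open>ar\<close> assigning arities.
\<close>

definition nat_tuples :: "nat \<Rightarrow> (nat \<Rightarrow> nat) set" where
  "nat_tuples n = ({..<n} \<rightarrow>\<^sub>E UNIV)"

definition Mod_nat :: "'r set \<Rightarrow> ('r \<Rightarrow> nat) \<Rightarrow> ('r \<Rightarrow> (nat \<Rightarrow> nat) \<Rightarrow> bool) topology" where
  "Mod_nat L ar =
     product_topology
       (\<lambda>R. product_topology (\<lambda>_. discrete_topology (UNIV :: bool set)) (nat_tuples (ar R))) L"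

definition S_infinity :: "(nat \<Rightarrow> nat) topology" where
  "S_infinity =
     subtopology (product_topology (\<lambda>_. discrete_topology (UNIV :: nat set)) (UNIV :: nat set)) {g. bij g}"

definition pushforward ::
  "'r set \<Rightarrow> ('r \<Rightarrow> nat) \<Rightarrow> (nat \<Rightarrow> nat) \<Rightarrow> ('r \<Rightarrow> (nat \<Rightarrow> nat) \<Rightarrow> bool)
    \<Rightarrow> 'r \<Rightarrow> (nat \<Rightarrow> nat) \<Rightarrow> bool" where
  "pushforward L ar g N =
     (\<lambda>R\<in>L. \<lambda>t\<in>nat_tuples (ar R). N R (\<lambda>i\<in>{..<ar R}. inv g (t i)))"

definition action_groupoid ::
  "'r set \<Rightarrow> ('r \<Rightarrow> nat)
    \<Rightarrow> ('r \<Rightarrow> (nat \<Rightarrow> nat) \<Rightarrow> bool, (nat \<Rightarrow> nat) \<times> ('r \<Rightarrow> (nat \<Rightarrow> nat) \<Rightarrow> bool)) top_groupoid" where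
  "action_groupoid L ar =
     \<lparr>Obj = Mod_nat L ar,
      Mor = prod_topology S_infinity (Mod_nat L ar),
      src = (\<lambda>(g, N). N),
      tgt = (\<lambda>(g, N). pushforward L ar g N),
      ident = (\<lambda>N. (id, N)),
      mcomp = (\<lambda>(g', N') (g, N). (g' \<circ> g, N))\<rparr>"


section \<open>Both groupoids satisfy the groupoid laws\<close>

lemma topspace_iso_topology: "topspace (iso_topology L X M) = iso_morphisms L X M"
proof
  show "topspace (iso_topology L X M) \<subseteq> iso_morphisms L X M"
    unfolding iso_topology_def topology_generated_by_topspace by blast
  have "{(x, y, h) \<in> iso_morphisms L X M. x \<in> topspace X} = iso_morphisms L X M"
    by (auto simp: iso_morphisms_def)
  then have "iso_morphisms L X M \<in> {{(x, y, h) \<in> iso_morphisms L X M. x \<in> U} |U. openin X U}"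
    using openin_topspace[of X] by (intro CollectI exI[of _ "topspace X"]) simp
  then show "iso_morphisms L X M \<subseteq> topspace (iso_topology L X M)"
    unfolding iso_topology_def topology_generated_by_topspace by (intro Union_upper UnI1)
qed

lemma iso_morphisms_iff:
  "(x, y, h) \<in> iso_morphisms L X M \<longleftrightarrow>
     x \<in> topspace X \<and> y \<in> topspace X \<and>
     h \<in> (\<Pi>\<^sub>E P\<in>sorts L. extensional (carr (fiber M x) P)) \<and>
     structure_iso L (fiber M x) (fiber M y) h"
  by (simp add: iso_morphisms_def)

lemma fiber_op:
  assumes "etale_structure L X M" "x \<in> topspace X" "f \<in> funs L" "a \<in> tuples (fiber M x) (fun_arity L f)"
  shows "op (fiber M x) f a \<in> carr (fiber M x) (fun_sort L f)"
proof -
  have "(x, a) \<in> topspace (fiber_product X M (fun_arity L f))"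
    using assms(2,4) by (auto simp: fiber_product_def tuples_def fiber_def PiE_iff)
  then show ?thesis
    using assms(1,3) unfolding etale_structure_def fiber_def continuous_map_def by fastforce
qed

lemma map_tuple_in:
  assumes "\<forall>P\<in>sorts L. h P \<in> carr A P \<rightarrow> carr B P" "set w \<subseteq> sorts L" "a \<in> tuples A w"
  shows "map_tuple h w a \<in> tuples B w"
proof -
  have "w ! i \<in> sorts L" if "i < length w" for i
    using assms(2) that nth_mem by blast
  then show ?thesis
    using assms(1,3) by (auto simp: map_tuple_def tuples_def PiE_iff Pi_iff)
qed

lemma map_tuple_cong:
  assumes "\<And>P b. P \<in> sorts L \<Longrightarrow> b \<in> carr A P \<Longrightarrow> h P b = k P b" "set w \<subseteq> sorts L" "a \<in> tuples A w"
  shows "map_tuple h w a = map_tuple k w a"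
proof -
  have "w ! i \<in> sorts L" if "i < length w" for i
    using assms(2) that nth_mem by blast
  then show ?thesis
    using assms(1,3) by (auto simp: map_tuple_def tuples_def PiE_iff fun_eq_iff)
qed

lemma map_tuple_comp: "map_tuple k w (map_tuple h w a) = map_tuple (\<lambda>P b. k P (h P b)) w a"
  by (auto simp: map_tuple_def)

lemma map_tuple_id: "a \<in> tuples A w \<Longrightarrow> map_tuple (\<lambda>P b. b) w a = a"
  by (auto simp: map_tuple_def tuples_def PiE_iff extensional_def)

lemma structure_iso_cong:
  assumes L: "language L" and op: "\<And>f a. f \<in> funs L \<Longrightarrow> a \<in> tuples A (fun_arity L f) \<Longrightarrow> op A f a \<in> carr A (fun_sort L f)"
    and eq: "\<And>P b. P \<in> sorts L \<Longrightarrow> b \<in> carr A P \<Longrightarrow> h P b = k P b"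
    and iso: "structure_iso L A B h"
  shows "structure_iso L A B k"
proof -
  have mt: "map_tuple h w a = map_tuple k w a" if "set w \<subseteq> sorts L" "a \<in> tuples A w" for w a
    by (rule map_tuple_cong[of L A]) (use eq that in auto)
  have "bij_betw (k P) (carr A P) (carr B P)" if "P \<in> sorts L" for P
    using iso that eq[OF that] bij_betw_cong[of "carr A P" "h P" "k P" "carr B P"]
    by (auto simp: structure_iso_def)
  moreover have "a \<in> rel A R \<longleftrightarrow> map_tuple k (rel_arity L R) a \<in> rel B R"
    if "R \<in> rels L" "a \<in> tuples A (rel_arity L R)" for R a
    using iso that mt[of "rel_arity L R" a] L by (auto simp: structure_iso_def language_def)
  moreover have "k (fun_sort L f) (op A f a) = op B f (map_tuple k (fun_arity L f) a)"
    if "f \<in> funs L" "a \<in> tuples A (fun_arity L f)" for f a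
    using iso that mt[of "fun_arity L f" a] L eq op[OF that]
    by (auto simp: structure_iso_def language_def) metis
  ultimately show ?thesis by (simp add: structure_iso_def)
qed

lemma structure_iso_comp:
  assumes L: "language L"
    and h: "structure_iso L A B h" and k: "structure_iso L B C k"
  shows "structure_iso L A C (\<lambda>P b. k P (h P b))"
proof -
  have mt: "map_tuple h w a \<in> tuples B w" if "set w \<subseteq> sorts L" "a \<in> tuples A w" for w a
    by (rule map_tuple_in[of L h A]) (use h that in \<open>auto simp: structure_iso_def bij_betw_def\<close>)
  have "bij_betw (\<lambda>b. k P (h P b)) (carr A P) (carr C P)" if "P \<in> sorts L" for P
    using h k that bij_betw_trans[of "h P" "carr A P" "carr B P" "k P" "carr C P"]
    by (auto simp: structure_iso_def comp_def)
  moreover have "a \<in> rel A R \<longleftrightarrow> map_tuple (\<lambda>P b. k P (h P b)) (rel_arity L R) a \<in> rel C R"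
    if "R \<in> rels L" "a \<in> tuples A (rel_arity L R)" for R a
    using h k that mt[of "rel_arity L R" a] L
    by (simp add: structure_iso_def language_def flip: map_tuple_comp)
  moreover have "k (fun_sort L f) (h (fun_sort L f) (op A f a))
      = op C f (map_tuple (\<lambda>P b. k P (h P b)) (fun_arity L f) a)"
    if "f \<in> funs L" "a \<in> tuples A (fun_arity L f)" for f a
    using h k that mt[of "fun_arity L f" a] L
    by (simp add: structure_iso_def language_def flip: map_tuple_comp)
  ultimately show ?thesis by (simp add: structure_iso_def)
qed

lemma structure_iso_id: "structure_iso L A A (\<lambda>P b. b)"
  by (simp add: structure_iso_def map_tuple_id bij_betw_def)

lemma structure_iso_inv:
  assumes L: "language L"
    and op: "\<And>f a. f \<in> funs L \<Longrightarrow> a \<in> tuples A (fun_arity L f) \<Longrightarrow> op A f a \<in> carr A (fun_sort L f)"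
    and h: "structure_iso L A B h"
  shows "structure_iso L B A (\<lambda>P. inv_into (carr A P) (h P))"
proof -
  let ?k = "\<lambda>P. inv_into (carr A P) (h P)"
  have bij: "bij_betw (h P) (carr A P) (carr B P)" if "P \<in> sorts L" for P
    using h that by (simp add: structure_iso_def)
  have mt: "map_tuple ?k w a \<in> tuples A w" if "set w \<subseteq> sorts L" "a \<in> tuples B w" for w a
    by (rule map_tuple_in[of L ?k B A])
      (use that bij in \<open>auto simp: bij_betw_def intro: inv_into_into\<close>)
  have hk: "map_tuple h w (map_tuple ?k w a) = a" if "set w \<subseteq> sorts L" "a \<in> tuples B w" for w a
  proof -
    have "map_tuple (\<lambda>P b. h P (?k P b)) w a = map_tuple (\<lambda>P b. b) w a"
      by (rule map_tuple_cong[of L B]) (use that bij in \<open>auto intro: bij_betw_inv_into_right\<close>)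
    then show ?thesis using that by (simp add: map_tuple_comp map_tuple_id)
  qed
  have "a \<in> rel B R \<longleftrightarrow> map_tuple ?k (rel_arity L R) a \<in> rel A R"
    if "R \<in> rels L" "a \<in> tuples B (rel_arity L R)" for R a
    using h that mt[of "rel_arity L R" a] hk[of "rel_arity L R" a] L
    by (simp add: structure_iso_def language_def)
  moreover have "?k (fun_sort L f) (op B f a) = op A f (map_tuple ?k (fun_arity L f) a)"
    if "f \<in> funs L" "a \<in> tuples B (fun_arity L f)" for f a
  proof -
    have w: "set (fun_arity L f) \<subseteq> sorts L" "fun_sort L f \<in> sorts L"
      using L that by (auto simp: language_def)
    let ?b = "map_tuple ?k (fun_arity L f) a"
    have "h (fun_sort L f) (op A f ?b) = op B f a"
      using h that mt[OF w(1) that(2)] hk[OF w(1) that(2)] by (simp add: structure_iso_def)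
    then show ?thesis
      using op[OF that(1) mt[OF w(1) that(2)]] bij[OF w(2)] bij_betw_inv_into_left by metis
  qed
  ultimately show ?thesis
    using bij by (simp add: structure_iso_def bij_betw_inv_into)
qed

lemma is_groupoid_iso_groupoid:
  assumes M: "etale_structure L X M"
  shows "is_groupoid (iso_groupoid L X M)"
proof -
  let ?G = "iso_groupoid L X M" and ?u = "\<lambda>x. carr (fiber M x)"
  have L: "language L" using M by (simp add: etale_structure_def)
  note fop = fiber_op[OF M]
  have hom: "m \<in> hom_set ?G x y \<longleftrightarrow> (\<exists>h. m = (x, y, h) \<and> (x, y, h) \<in> iso_morphisms L X M)" for m x y
    by (cases m) (auto simp: hom_set_def iso_groupoid_def topspace_iso_topology)
  have maps: "h P b \<in> ?u y P"
    if "(x, y, h) \<in> iso_morphisms L X M" "P \<in> sorts L" "b \<in> ?u x P" for x y h P b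
    using that by (auto simp: iso_morphisms_iff structure_iso_def bij_betw_def)
  have eqI: "h = (\<lambda>P\<in>sorts L. \<lambda>b\<in>?u x P. k P b)"
    if "h \<in> (\<Pi>\<^sub>E P\<in>sorts L. extensional (?u x P))" "\<And>P b. P \<in> sorts L \<Longrightarrow> b \<in> ?u x P \<Longrightarrow> h P b = k P b"
    for h k x
    using that by (force simp: PiE_iff extensional_def fun_eq_iff)
  have mor: "(x, y, \<lambda>P\<in>sorts L. \<lambda>b\<in>?u x P. k P b) \<in> iso_morphisms L X M"
    if "x \<in> topspace X" "y \<in> topspace X" "structure_iso L (fiber M x) (fiber M y) k" for x y k
    unfolding iso_morphisms_iff
    using that structure_iso_cong[OF L fop[OF that(1)] _ that(3), of "\<lambda>P\<in>sorts L. \<lambda>b\<in>?u x P. k P b"]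
    by (auto simp: PiE_iff)
  have obj: "x \<in> topspace X" "y \<in> topspace X" "h \<in> (\<Pi>\<^sub>E P\<in>sorts L. extensional (?u x P))"
    "structure_iso L (fiber M x) (fiber M y) h"
    if "(x, y, h) \<in> iso_morphisms L X M" for x y h using that by (auto simp: iso_morphisms_iff)
  show ?thesis
    unfolding is_groupoid_def
  proof (intro conjI allI ballI)
    fix f assume "f \<in> arrows ?G"
    then show "src ?G f \<in> objects ?G" "tgt ?G f \<in> objects ?G"
      by (auto simp: iso_groupoid_def topspace_iso_topology iso_morphisms_iff split: prod.splits)
  next
    fix x assume "x \<in> objects ?G"
    then have "x \<in> topspace X" by (simp add: iso_groupoid_def)
    then show "ident ?G x \<in> hom_set ?G x x"
      unfolding hom by (simp add: iso_groupoid_def mor structure_iso_id)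
  next
    fix x y z f g assume "f \<in> hom_set ?G x y" "g \<in> hom_set ?G y z"
    then obtain h k where *: "f = (x, y, h)" "(x, y, h) \<in> iso_morphisms L X M"
        "g = (y, z, k)" "(y, z, k) \<in> iso_morphisms L X M"
      unfolding hom by blast
    show "mcomp ?G g f \<in> hom_set ?G x z"
      unfolding hom
      using mor[OF obj(1)[OF *(2)] obj(2)[OF *(4)] structure_iso_comp[OF L obj(4)[OF *(2)] obj(4)[OF *(4)]]]
      by (simp add: iso_groupoid_def *(1,3))
  next
    fix x y f assume "f \<in> hom_set ?G x y"
    then obtain h where *: "f = (x, y, h)" "(x, y, h) \<in> iso_morphisms L X M"
      unfolding hom by blast
    have "h = (\<lambda>P\<in>sorts L. \<lambda>a\<in>?u x P. h P ((\<lambda>P\<in>sorts L. \<lambda>a\<in>?u x P. a) P a))"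
      by (rule eqI[OF obj(3)[OF *(2)]]) simp
    from this[symmetric] show "mcomp ?G f (ident ?G x) = f"
      unfolding *(1) by (simp add: iso_groupoid_def)
    have "h = (\<lambda>P\<in>sorts L. \<lambda>a\<in>?u x P. (\<lambda>P\<in>sorts L. \<lambda>a\<in>?u y P. a) P (h P a))"
      by (rule eqI[OF obj(3)[OF *(2)]]) (simp add: maps[OF *(2)])
    from this[symmetric] show "mcomp ?G (ident ?G y) f = f"
      unfolding *(1) by (simp add: iso_groupoid_def)
  next
    fix x y z w f g h assume "f \<in> hom_set ?G x y" "g \<in> hom_set ?G y z" "h \<in> hom_set ?G z w"
    then obtain f' g' h' where *: "f = (x, y, f')" "(x, y, f') \<in> iso_morphisms L X M"
        "g = (y, z, g')" "h = (z, w, h')"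
      unfolding hom by blast
    show "mcomp ?G h (mcomp ?G g f) = mcomp ?G (mcomp ?G h g) f"
      by (simp add: iso_groupoid_def *(1,3,4) fun_eq_iff maps[OF *(2)] restrict_def)
  next
    fix x y f assume "f \<in> hom_set ?G x y"
    then obtain h where f: "f = (x, y, h)" and m: "(x, y, h) \<in> iso_morphisms L X M"
      unfolding hom by auto
    let ?k = "\<lambda>P. inv_into (?u x P) (h P)"
    have bij: "bij_betw (h P) (?u x P) (?u y P)" if "P \<in> sorts L" for P
      using obj(4)[OF m] that by (simp add: structure_iso_def)
    let ?g = "(y, x, \<lambda>P\<in>sorts L. \<lambda>b\<in>?u y P. ?k P b)"
    have "?g \<in> hom_set ?G y x"
      unfolding hom using mor structure_iso_inv[OF L fop[OF obj(1)[OF m]] obj(4)[OF m]] obj[OF m] by blast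
    moreover have "mcomp ?G ?g f = ident ?G x" "mcomp ?G f ?g = ident ?G y"
      unfolding f
      by (auto simp: iso_groupoid_def fun_eq_iff bij[THEN bij_betw_inv_into_left]
          bij[THEN bij_betw_inv_into_right] maps[OF m])
    ultimately show "\<exists>g\<in>hom_set ?G y x. mcomp ?G g f = ident ?G x \<and> mcomp ?G f g = ident ?G y"
      by blast
  qed
qed

lemma topspace_Mod_nat: "topspace (Mod_nat L ar) = (\<Pi>\<^sub>E R\<in>L. nat_tuples (ar R) \<rightarrow>\<^sub>E UNIV)"
  by (simp add: Mod_nat_def)

lemma topspace_S_infinity: "topspace S_infinity = {g. bij g}"
  by (simp add: S_infinity_def PiE_UNIV_domain)

lemma pushforward_in: "pushforward L ar g N \<in> topspace (Mod_nat L ar)"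
  by (auto simp: topspace_Mod_nat pushforward_def)

lemma pushforward_id:
  assumes "N \<in> topspace (Mod_nat L ar)" shows "pushforward L ar id N = N"
proof -
  have t: "(\<lambda>i\<in>{..<n}. t i) = t" if "t \<in> nat_tuples n" for n t
    using that by (auto simp: nat_tuples_def PiE_iff extensional_restrict)
  have N: "N \<in> extensional L" "\<And>R. R \<in> L \<Longrightarrow> N R \<in> extensional (nat_tuples (ar R))"
    using assms by (auto simp: topspace_Mod_nat PiE_iff)
  have "pushforward L ar id N R t = N R t" for R t
    using t[of t "ar R"] extensional_arb[OF N(1), of R] extensional_arb[OF N(2), of R t]
    by (cases "R \<in> L"; cases "t \<in> nat_tuples (ar R)") (simp_all add: pushforward_def)
  then show ?thesis by (intro ext)
qed

lemma pushforward_comp: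
  assumes "bij g" "bij h" shows "pushforward L ar h (pushforward L ar g N) = pushforward L ar (h \<circ> g) N"
proof -
  have i: "inv (h \<circ> g) = inv g \<circ> inv h" using assms by (simp add: o_inv_distrib)
  have "pushforward L ar h (pushforward L ar g N) R t = pushforward L ar (h \<circ> g) N R t" for R t
  proof (cases "R \<in> L \<and> t \<in> nat_tuples (ar R)")
    case True
    moreover have "(\<lambda>i\<in>{..<ar R}. inv h (t i)) \<in> nat_tuples (ar R)" by (simp add: nat_tuples_def)
    moreover have "(\<lambda>i\<in>{..<ar R}. inv g ((\<lambda>i\<in>{..<ar R}. inv h (t i)) i))
        = (\<lambda>i\<in>{..<ar R}. inv (h \<circ> g) (t i))"
      by (simp add: i fun_eq_iff)
    ultimately show ?thesis by (simp only: pushforward_def restrict_apply if_True)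
  qed (auto simp: pushforward_def)
  then show ?thesis by (intro ext)
qed

lemma is_groupoid_action_groupoid: "is_groupoid (action_groupoid L ar)"
proof -
  let ?G = "action_groupoid L ar"
  have hom: "m \<in> hom_set ?G x y \<longleftrightarrow>
     (\<exists>g. m = (g, x) \<and> bij g \<and> x \<in> topspace (Mod_nat L ar) \<and> y = pushforward L ar g x)" for m x y
    by (cases m) (auto simp: hom_set_def action_groupoid_def topspace_S_infinity)
  show ?thesis
    unfolding is_groupoid_def
  proof (intro conjI allI ballI)
    fix x y f assume "f \<in> hom_set ?G x y"
    then obtain g where f: "f = (g, x)" "bij g" "x \<in> topspace (Mod_nat L ar)" "y = pushforward L ar g x"
      unfolding hom by auto
    then have "(inv g, y) \<in> hom_set ?G y x"
      by (simp add: hom pushforward_in bij_imp_bij_inv pushforward_comp pushforward_id bij_is_inj)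
    moreover have "mcomp ?G (inv g, y) f = ident ?G x" "mcomp ?G f (inv g, y) = ident ?G y"
      using f by (simp_all add: action_groupoid_def bij_is_inj bij_is_surj surj_iff[THEN iffD1])
    ultimately show "\<exists>g\<in>hom_set ?G y x. mcomp ?G g f = ident ?G x \<and> mcomp ?G f g = ident ?G y" by blast
  next
    fix x y f assume "f \<in> hom_set ?G x y"
    then show "mcomp ?G f (ident ?G x) = f" "mcomp ?G (ident ?G y) f = f"
      unfolding hom by (auto simp: action_groupoid_def)
  next
    fix f assume "f \<in> arrows ?G"
    then show "src ?G f \<in> objects ?G" "tgt ?G f \<in> objects ?G"
      by (auto simp: action_groupoid_def pushforward_in)
  next
    fix x assume "x \<in> objects ?G"
    then show "ident ?G x \<in> hom_set ?G x x"
      unfolding hom by (auto simp: action_groupoid_def pushforward_id)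
  next
    fix x y z f g assume "f \<in> hom_set ?G x y" "g \<in> hom_set ?G y z"
    then show "mcomp ?G g f \<in> hom_set ?G x z"
      unfolding hom by (auto simp: action_groupoid_def pushforward_comp bij_comp)
  next
    fix x y z w f g h assume "f \<in> hom_set ?G x y" "g \<in> hom_set ?G y z" "h \<in> hom_set ?G z w"
    then show "mcomp ?G h (mcomp ?G g f) = mcomp ?G (mcomp ?G h g) f"
      unfolding hom by (auto simp: action_groupoid_def comp_assoc)
  qed
qed

end

theory Submission
  imports Defs
begin

text \<open>
  Why the theorem is true.  Each fiber of \<open>M\<close> is a countable multi-sorted structure, but fibers may
  be finite or even empty, and they are not given on the set of natural numbers.  Both defects are
  repaired fiber by fiber.  Over \<open>x\<close> put the disjoint union \<open>E\<^sub>x\<close> of all sorts of the fiber and one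
  further copy of the natural numbers, with a unary relation for every sort, for every added number
  a unary relation that names it, the given relations, and the graphs of the given operations.  The set
  \<open>E\<^sub>x\<close> is countably infinite.  Since the added numbers are named, they are fixed by every isomorphism,
  and since the sorts are named, an isomorphism \<open>E\<^sub>x \<cong> E\<^sub>y\<close> is the same thing as an isomorphism between
  the fibers over \<open>x\<close> and \<open>y\<close>: this is the content of \<open>preserves_symbols_lift\<close> and
  \<open>preserves_symbols_imp_lift\<close>.

  It remains to enumerate \<open>E\<^sub>x\<close> in a way that depends on \<open>x\<close> in a Borel manner.  By second countability
  the total space of all \<open>E\<^sub>x\<close> is covered by countably many cells, each a single added number or an open
  section of a sort, so that each cell meets each \<open>E\<^sub>x\<close> in at most one point (\<open>cells_exist\<close>).  Call the
  index of a cell live at \<open>x\<close> if the cell meets \<open>E\<^sub>x\<close> in a point that lies in no earlier cell.  The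
  points of \<open>E\<^sub>x\<close> correspond to the live indices, an infinite set of natural numbers; listing it in
  increasing order gives a bijection \<open>point x\<close> from the natural numbers onto \<open>E\<^sub>x\<close>.

  The functor sends \<open>x\<close> to the structure transported along \<open>point x\<close>, and an isomorphism \<open>h\<close> to its
  conjugate \<open>(point y)\<^sup>-\<^sup>1 \<circ> h \<circ> point x\<close>.  It is full and faithful because conjugation by bijections
  is.  It is Borel because everything can be read off from cells: which cells
  meet over \<open>x\<close>, whether a relation holds between the points of finitely many cells, and whether an
  isomorphism carries the point of one cell to the point of another are all open conditions
  (\<open>openin_points_meet_cells\<close>, \<open>openin_holds_meets_cells\<close>, \<open>openin_lift_maps_cell_to_cell\<close>).  The
  second of these rests on the fact that projections of fiber products of etale spaces to the base are
  open maps, and that equality of two continuous maps over the base into an etale space is an open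
  condition.
\<close>

section \<open>Borel measurability into products of countable discrete spaces\<close>

text \<open>
  The members of a subbase need not be subsets of the space; only their traces on the space matter.
  This lets the same sets serve for a space and for its subspaces, and lets the
  members for a product be plain preimages under the coordinates.
\<close>

definition countable_subbase :: "'a topology \<Rightarrow> 'a set set \<Rightarrow> bool" where
  "countable_subbase Y S \<longleftrightarrow> countable S \<and>
     (\<forall>U y. openin Y U \<and> y \<in> U \<longrightarrow> (\<exists>F. finite F \<and> F \<subseteq> S \<and> y \<in> \<Inter>F \<and> topspace Y \<inter> \<Inter>F \<subseteq> U))"

lemma countable_subbaseD:
  assumes "countable_subbase Y S" "openin Y U" "y \<in> U"
  obtains F where "finite F" "F \<subseteq> S" "y \<in> \<Inter>F" "topspace Y \<inter> \<Inter>F \<subseteq> U"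
  using assms unfolding countable_subbase_def by blast

lemma space_borel_of [simp]: "space (borel_of X) = topspace X"
  by (simp add: borel_of_def space_measure_of_conv)

lemma openin_in_borel_of: "openin X U \<Longrightarrow> U \<in> sets (borel_of X)"
  unfolding borel_of_def
  by (subst sets_measure_of) (auto dest: openin_subset intro: sigma_sets.Basic)

lemma measurable_borel_of_continuous:
  assumes "continuous_map Y Z f"
  shows "f \<in> measurable (borel_of Y) (borel_of Z)"
proof -
  have "f -` U \<inter> topspace Y \<in> sets (borel_of Y)" if "openin Z U" for U
    using openin_in_borel_of[OF openin_continuous_map_preimage[OF assms that]]
    by (simp add: vimage_def Int_def conj_commute)
  then show ?thesis
    using continuous_map_image_subset_topspace[OF assms] unfolding borel_of_def[of Z]
    by (intro measurable_measure_of) (auto dest: openin_subset)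
qed

text \<open>
  A countable subbase has only countably many finite subsets, so every open set is a countable union of
  finite intersections of members of the subbase.
\<close>

lemma measurable_borel_of_subbase:
  assumes S: "countable_subbase Y S"
    and f: "f \<in> space N \<rightarrow> topspace Y"
    and m: "\<And>V. V \<in> S \<Longrightarrow> f -` V \<inter> space N \<in> sets N"
  shows "f \<in> measurable N (borel_of Y)"
  unfolding borel_of_def
proof (rule measurable_measure_of)
  show "{U. openin Y U} \<subseteq> Pow (topspace Y)" by (auto dest: openin_subset)
next
  fix U assume "U \<in> {U. openin Y U}"
  then have U: "openin Y U" by simp
  define C where "C = {F. finite F \<and> F \<subseteq> S \<and> topspace Y \<inter> \<Inter>F \<subseteq> U}"
  have "countable {F. finite F \<and> F \<subseteq> S}"
    using S by (intro countable_Collect_finite_subset) (simp add: countable_subbase_def)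
  then have C: "countable C" by (rule countable_subset[rotated]) (auto simp: C_def)
  have preimage: "f -` U \<inter> space N = (\<Union>F\<in>C. {x \<in> space N. \<forall>V\<in>F. f x \<in> V})"
  proof (intro equalityI subsetI)
    fix x assume x: "x \<in> f -` U \<inter> space N"
    obtain F where "finite F" "F \<subseteq> S" "f x \<in> \<Inter>F" "topspace Y \<inter> \<Inter>F \<subseteq> U"
      using countable_subbaseD[OF S U, of "f x"] x by blast
    then show "x \<in> (\<Union>F\<in>C. {x \<in> space N. \<forall>V\<in>F. f x \<in> V})"
      using x by (auto simp: C_def)
  qed (use f in \<open>auto simp: C_def\<close>)
  have meas: "{x \<in> space N. \<forall>V\<in>F. f x \<in> V} \<in> sets N" if "F \<in> C" for F
    using that m by (intro sets.sets_Collect_finite_All) (auto simp: C_def vimage_def Int_def conj_commute)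
  have "(\<Union>F\<in>C. {x \<in> space N. \<forall>V\<in>F. f x \<in> V}) \<in> sets N"
    by (intro sets.countable_UN'[OF C]) (use meas in blast)
  then show "f -` U \<inter> space N \<in> sets N" by (simp only: preimage)
qed (use f in auto)

lemma countable_subbase_discrete:
  "countable A \<Longrightarrow> countable_subbase (discrete_topology A) ((\<lambda>a. {a}) ` A)"
  unfolding countable_subbase_def by (fastforce intro: exI[of _ "{{y}}" for y])

lemma countable_subbase_subtopology:
  assumes "countable_subbase Y S"
  shows "countable_subbase (subtopology Y A) S"
  unfolding countable_subbase_def
proof (intro conjI allI impI)
  show "countable S" using assms by (simp add: countable_subbase_def)
  fix U y assume "openin (subtopology Y A) U \<and> y \<in> U"
  then obtain V where V: "openin Y V" "U = V \<inter> A" "y \<in> V" by (auto simp: openin_subtopology)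
  then obtain F where "finite F" "F \<subseteq> S" "y \<in> \<Inter>F" "topspace Y \<inter> \<Inter>F \<subseteq> V"
    using countable_subbaseD[OF assms] by metis
  then show "\<exists>F. finite F \<and> F \<subseteq> S \<and> y \<in> \<Inter>F \<and> topspace (subtopology Y A) \<inter> \<Inter>F \<subseteq> U"
    using V by (intro exI[of _ F]) auto
qed

text \<open>
  A basic open box restricts only finitely many coordinates, and each restriction is refined by
  finitely many members of the subbase of that coordinate.
\<close>

lemma countable_subbase_product:
  assumes I: "countable I" and S: "\<And>i. i \<in> I \<Longrightarrow> countable_subbase (Y i) (S i)"
  shows "countable_subbase (product_topology Y I) (\<Union>i\<in>I. (\<lambda>V. {f. f i \<in> V}) ` S i)"
  unfolding countable_subbase_def
proof (intro conjI allI impI)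
  show "countable (\<Union>i\<in>I. (\<lambda>V. {f. f i \<in> V}) ` S i)"
    using I S by (auto simp: countable_subbase_def)
  fix W y assume "openin (product_topology Y I) W \<and> y \<in> W"
  then obtain U where U: "finite {i \<in> I. U i \<noteq> topspace (Y i)}" "\<And>i. i \<in> I \<Longrightarrow> openin (Y i) (U i)"
      "y \<in> Pi\<^sub>E I U" "Pi\<^sub>E I U \<subseteq> W"
    unfolding openin_product_topology_alt by metis
  have "\<exists>F. finite F \<and> F \<subseteq> S i \<and> y i \<in> \<Inter>F \<and> topspace (Y i) \<inter> \<Inter>F \<subseteq> U i" if "i \<in> I" for i
    using countable_subbaseD[OF S[OF that] U(2)[OF that], of "y i"] that U(3) by (metis PiE_mem)
  then obtain F where F: "\<And>i. i \<in> I \<Longrightarrow> finite (F i)" "\<And>i. i \<in> I \<Longrightarrow> F i \<subseteq> S i"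
      "\<And>i. i \<in> I \<Longrightarrow> y i \<in> \<Inter>(F i)" "\<And>i. i \<in> I \<Longrightarrow> topspace (Y i) \<inter> \<Inter>(F i) \<subseteq> U i"
    by metis
  let ?J = "{i \<in> I. U i \<noteq> topspace (Y i)}"
  let ?F = "\<Union>i\<in>?J. (\<lambda>V. {f. f i \<in> V}) ` F i"
  have "topspace (product_topology Y I) \<inter> \<Inter>?F \<subseteq> Pi\<^sub>E I U"
  proof
    fix f assume f: "f \<in> topspace (product_topology Y I) \<inter> \<Inter>?F"
    have "f i \<in> U i" if i: "i \<in> I" for i
    proof (cases "i \<in> ?J")
      case True
      then have "f i \<in> \<Inter>(F i)" using f by auto
      then show ?thesis using F(4)[OF i] f i by (auto simp: PiE_iff)
    next
      case False then show ?thesis using f i by (auto simp: PiE_iff)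
    qed
    then show "f \<in> Pi\<^sub>E I U" using f by (simp add: PiE_iff)
  qed
  moreover have "finite ?F" using U(1) F(1) by auto
  moreover have "?F \<subseteq> (\<Union>i\<in>I. (\<lambda>V. {f. f i \<in> V}) ` S i)" using F(2) by blast
  moreover have "y \<in> \<Inter>?F" using F(3) by auto
  ultimately show "\<exists>F. finite F \<and> F \<subseteq> (\<Union>i\<in>I. (\<lambda>V. {f. f i \<in> V}) ` S i) \<and> y \<in> \<Inter>F \<and>
      topspace (product_topology Y I) \<inter> \<Inter>F \<subseteq> W"
    using subset_trans[OF _ U(4)] by (intro exI[of _ ?F] conjI)
qed

lemma countable_subbase_prod:
  assumes S: "countable_subbase Y S" and T: "countable_subbase Z T"
  shows "countable_subbase (prod_topology Y Z) ((\<lambda>V. V \<times> UNIV) ` S \<union> (\<lambda>V. UNIV \<times> V) ` T)"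
  unfolding countable_subbase_def
proof (intro conjI allI impI)
  show "countable ((\<lambda>V. V \<times> UNIV) ` S \<union> (\<lambda>V. UNIV \<times> V) ` T)"
    using S T by (auto simp: countable_subbase_def)
  fix W p assume "openin (prod_topology Y Z) W \<and> p \<in> W"
  then obtain U V where UV: "openin Y U" "openin Z V" "fst p \<in> U" "snd p \<in> V" "U \<times> V \<subseteq> W"
    unfolding openin_prod_topology_alt by (metis prod.collapse)
  obtain F where F: "finite F" "F \<subseteq> S" "fst p \<in> \<Inter>F" "topspace Y \<inter> \<Inter>F \<subseteq> U"
    using countable_subbaseD[OF S UV(1,3)] .
  obtain G where G: "finite G" "G \<subseteq> T" "snd p \<in> \<Inter>G" "topspace Z \<inter> \<Inter>G \<subseteq> V"
    using countable_subbaseD[OF T UV(2,4)] .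
  let ?F = "(\<lambda>V. V \<times> UNIV) ` F \<union> (\<lambda>V. UNIV \<times> V) ` G"
  have "topspace (prod_topology Y Z) \<inter> \<Inter>?F \<subseteq> U \<times> V"
  proof
    fix q assume "q \<in> topspace (prod_topology Y Z) \<inter> \<Inter>?F"
    then have "fst q \<in> topspace Y \<inter> \<Inter>F" "snd q \<in> topspace Z \<inter> \<Inter>G"
      by (auto simp: mem_Times_iff ball_Un)
    then show "q \<in> U \<times> V" using F(4) G(4) by (auto simp: mem_Times_iff)
  qed
  moreover have "p \<in> \<Inter>?F" using F(3) G(3) by (auto simp: mem_Times_iff)
  ultimately show "\<exists>F. finite F \<and> F \<subseteq> (\<lambda>V. V \<times> UNIV) ` S \<union> (\<lambda>V. UNIV \<times> V) ` T \<and> p \<in> \<Inter>F \<and>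
      topspace (prod_topology Y Z) \<inter> \<Inter>F \<subseteq> W"
    using F(1,2) G(1,2) subset_trans[OF _ UV(5)] by (intro exI[of _ ?F] conjI) auto
qed

lemma countable_nat_tuples: "countable (nat_tuples n)"
  unfolding nat_tuples_def by (intro countable_PiE) auto

lemma countable_subbase_Mod_nat:
  fixes ar :: "'r \<Rightarrow> nat"
  assumes "countable L"
  shows "countable_subbase (Mod_nat L ar) {{N. N R t = b} |R t b. R \<in> L \<and> t \<in> nat_tuples (ar R)}"
proof -
  have "countable_subbase (Mod_nat L ar) (\<Union>R\<in>L. (\<lambda>V. {N. N R \<in> V}) `
     (\<Union>t\<in>nat_tuples (ar R). (\<lambda>V. {f. f t \<in> V}) ` (\<lambda>b. {b}) ` UNIV))"
    unfolding Mod_nat_def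
    by (intro countable_subbase_product countable_subbase_discrete countable_nat_tuples assms) auto
  also have "(\<Union>R\<in>L. (\<lambda>V. {N. N R \<in> V}) `
     (\<Union>t\<in>nat_tuples (ar R). (\<lambda>V. {f. f t \<in> V}) ` (\<lambda>b. {b}) ` UNIV)) =
     {{N. N R t = b} |R t b. R \<in> L \<and> t \<in> nat_tuples (ar R)}"
    by (force simp: image_UN image_image)
  finally show ?thesis .
qed

lemma countable_subbase_S_infinity: "countable_subbase S_infinity {{g. g n = k} |n k. True}"
proof -
  have "countable_subbase S_infinity (\<Union>n\<in>UNIV. (\<lambda>V. {g. g n \<in> V}) ` (\<lambda>k. {k}) ` UNIV)"
    unfolding S_infinity_def
    by (intro countable_subbase_subtopology countable_subbase_product countable_subbase_discrete) auto
  also have "(\<Union>n\<in>UNIV. (\<lambda>V. {g. g n \<in> V}) ` (\<lambda>k. {k}) ` UNIV) = {{g. g n = k} |n k. True}"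
    by (auto simp: image_image)
  finally show ?thesis .
qed

lemma preimage_truth_value_in_sets:
  assumes "{x \<in> space Q. P x} \<in> sets Q"
  shows "{x \<in> space Q. P x = b} \<in> sets Q"
proof (cases b)
  case False
  have "{x \<in> space Q. P x = b} = space Q - {x \<in> space Q. P x}" using False by auto
  then show ?thesis using assms by simp
qed (use assms in simp)

lemma measurable_Mod_nat:
  assumes "countable L" "\<And>x. x \<in> space Q \<Longrightarrow> F x \<in> topspace (Mod_nat L ar)"
    and F: "\<And>R t. R \<in> L \<Longrightarrow> t \<in> nat_tuples (ar R) \<Longrightarrow> {x \<in> space Q. F x R t} \<in> sets Q"
  shows "F \<in> measurable Q (borel_of (Mod_nat L ar))"
proof (rule measurable_borel_of_subbase[OF countable_subbase_Mod_nat])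
  fix V assume "V \<in> {{N. N R t = (b :: bool)} |R t b. R \<in> L \<and> t \<in> nat_tuples (ar R)}"
  then obtain R t and b :: bool where *: "R \<in> L" "t \<in> nat_tuples (ar R)" and V: "V = {N. N R t = b}" by blast
  have "F -` V \<inter> space Q = {x \<in> space Q. F x R t = b}" by (auto simp: V)
  then show "F -` V \<inter> space Q \<in> sets Q" using preimage_truth_value_in_sets[OF F[OF *]] by simp
qed (use assms in auto)

lemma measurable_action_morphism:
  assumes "countable L" "\<And>m. m \<in> space Q \<Longrightarrow> bij (g m)"
    "\<And>m. m \<in> space Q \<Longrightarrow> F m \<in> topspace (Mod_nat L ar)"
    and g: "\<And>n k. {m \<in> space Q. g m n = k} \<in> sets Q"
    and F: "\<And>R t. R \<in> L \<Longrightarrow> t \<in> nat_tuples (ar R) \<Longrightarrow> {m \<in> space Q. F m R t} \<in> sets Q"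
  shows "(\<lambda>m. (g m, F m)) \<in> measurable Q (borel_of (prod_topology S_infinity (Mod_nat L ar)))"
proof (rule measurable_borel_of_subbase[OF countable_subbase_prod[OF countable_subbase_S_infinity countable_subbase_Mod_nat]])
  fix V assume "V \<in> (\<lambda>V. V \<times> UNIV) ` {{g :: nat \<Rightarrow> nat. g n = k} |n k. True} \<union>
    (\<lambda>V. UNIV \<times> V) ` {{N. N R t = (b :: bool)} |R t b. R \<in> L \<and> t \<in> nat_tuples (ar R)}"
  then consider n k :: nat where "V = {g. g n = k} \<times> UNIV"
    | R t and b :: bool where "R \<in> L" "t \<in> nat_tuples (ar R)" "V = UNIV \<times> {N. N R t = b}" by blast
  then show "(\<lambda>m. (g m, F m)) -` V \<inter> space Q \<in> sets Q"
  proof cases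
    case 1
    then have "(\<lambda>m. (g m, F m)) -` V \<inter> space Q = {m \<in> space Q. g m n = k}" by auto
    then show ?thesis using g by simp
  next
    case 2
    then have "(\<lambda>m. (g m, F m)) -` V \<inter> space Q = {m \<in> space Q. F m R t = b}" by auto
    then show ?thesis using preimage_truth_value_in_sets[OF F[OF 2(1,2)]] by simp
  qed
qed (use assms in \<open>auto simp: topspace_S_infinity\<close>)

section \<open>Enumerating the members of an infinite Borel family of countable sets\<close>

text \<open>
  A family of infinite sets \<open>E x\<close>, with countably many cells that cover each of them and meet each of
  them in at most one point.  A cell is the graph of a partial section of the family; the last
  assumption makes both the domain of each section (\<open>j = k\<close>) and the set where two sections
  agree measurable.
\<close>

locale cell_family =
  fixes N :: "'x measure" and E :: "'x \<Rightarrow> 'e set" and cell :: "nat \<Rightarrow> 'e set"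
  assumes infinite_fiber: "x \<in> space N \<Longrightarrow> infinite (E x)"
    and cells_cover: "x \<in> space N \<Longrightarrow> E x \<subseteq> (\<Union>k. cell k)"
    and cell_unique: "\<lbrakk>x \<in> space N; u \<in> E x; v \<in> E x; u \<in> cell k; v \<in> cell k\<rbrakk> \<Longrightarrow> u = v"
    and cells_meet: "{x \<in> space N. E x \<inter> cell j \<inter> cell k \<noteq> {}} \<in> sets N"
begin

text \<open>
  Taking the least index of a cell through a given point selects exactly one index per point, although
  cells may overlap.
\<close>

definition live :: "'x \<Rightarrow> nat set" where
  "live x = {k. E x \<inter> cell k \<noteq> {} \<and> (\<forall>j<k. E x \<inter> cell j \<inter> cell k = {})}"

definition addr :: "'x \<Rightarrow> nat \<Rightarrow> nat" where
  "addr x n = enumerate (live x) n"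

definition point :: "'x \<Rightarrow> nat \<Rightarrow> 'e" where
  "point x n = the_elem (E x \<inter> cell (addr x n))"

lemma the_elem_cell:
  assumes "x \<in> space N" "u \<in> E x" "u \<in> cell k" shows "the_elem (E x \<inter> cell k) = u"
proof -
  have "E x \<inter> cell k = {u}" using assms cell_unique by blast
  then show ?thesis by simp
qed

text \<open>
  Two distinct live indices cannot give the same point, because the larger one would meet an earlier
  cell over that point.
\<close>

lemma bij_live:
  assumes x: "x \<in> space N"
  shows "bij_betw (\<lambda>k. the_elem (E x \<inter> cell k)) (live x) (E x)"
proof (rule bij_betwI')
  fix k assume "k \<in> live x"
  then obtain u where u: "u \<in> E x" "u \<in> cell k" by (auto simp: live_def)
  then show "the_elem (E x \<inter> cell k) \<in> E x" by (simp add: the_elem_cell[OF x u])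
next
  fix j k assume jk: "j \<in> live x" "k \<in> live x"
  obtain u where u: "u \<in> E x" "u \<in> cell j" using jk by (auto simp: live_def)
  obtain v where v: "v \<in> E x" "v \<in> cell k" using jk by (auto simp: live_def)
  show "(the_elem (E x \<inter> cell j) = the_elem (E x \<inter> cell k)) = (j = k)"
  proof
    assume "the_elem (E x \<inter> cell j) = the_elem (E x \<inter> cell k)"
    then have "u = v" by (simp add: the_elem_cell[OF x u] the_elem_cell[OF x v])
    then show "j = k" using jk u v by (cases j k rule: linorder_cases) (auto simp: live_def)
  qed simp
next
  fix u assume u: "u \<in> E x"
  then obtain k where "u \<in> cell k" using cells_cover[OF x] by blast
  let ?k = "LEAST k. u \<in> cell k"
  have k: "u \<in> cell ?k" by (rule LeastI) fact
  have "?k \<in> live x"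
    unfolding live_def
  proof (intro CollectI conjI allI impI)
    show "E x \<inter> cell ?k \<noteq> {}" using u k by blast
    fix j assume "j < ?k"
    then have "u \<notin> cell j" by (rule not_less_Least)
    then show "E x \<inter> cell j \<inter> cell ?k = {}" using cell_unique[OF x _ u _ k] by blast
  qed
  then show "\<exists>k\<in>live x. u = the_elem (E x \<inter> cell k)"
    using the_elem_cell[OF x u k] by (intro bexI[of _ ?k]) auto
qed

lemma infinite_live: "x \<in> space N \<Longrightarrow> infinite (live x)"
  using bij_betw_finite[OF bij_live] infinite_fiber by blast

lemma bij_point: "x \<in> space N \<Longrightarrow> bij_betw (point x) UNIV (E x)"
  using bij_betw_trans[OF bij_enumerate[OF infinite_live] bij_live]
  by (simp add: comp_def point_def[abs_def] addr_def)

lemma point_in [simp]: "x \<in> space N \<Longrightarrow> point x n \<in> E x"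
  using bij_point by (force simp: bij_betw_def)

lemma point_in_cell:
  assumes x: "x \<in> space N" shows "point x n \<in> cell (addr x n)"
proof -
  have "addr x n \<in> live x" unfolding addr_def by (rule enumerate_in_set[OF infinite_live[OF x]])
  then obtain u where u: "u \<in> E x" "u \<in> cell (addr x n)" by (auto simp: live_def)
  then show ?thesis by (simp add: point_def the_elem_cell[OF x u])
qed

lemma pred_live: "Measurable.pred N (\<lambda>x. k \<in> live x)"
proof -
  have meet [measurable]: "Measurable.pred N (\<lambda>x. E x \<inter> cell j \<inter> cell k \<noteq> {})" for j k
    using cells_meet by (simp add: pred_def)
  have [measurable]: "Measurable.pred N (\<lambda>x. E x \<inter> cell k \<noteq> {})"
    using meet[of k k] by (simp add: Int_assoc)
  have "(k \<in> live x) = (E x \<inter> cell k \<noteq> {} \<and> (\<forall>j. j < k \<longrightarrow> \<not> E x \<inter> cell j \<inter> cell k \<noteq> {}))" for x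
    by (simp add: live_def)
  moreover have "Measurable.pred N (\<lambda>x. E x \<inter> cell k \<noteq> {} \<and> (\<forall>j. j < k \<longrightarrow> \<not> E x \<inter> cell j \<inter> cell k \<noteq> {}))"
    by measurable
  ultimately show ?thesis by (simp only:)
qed

text \<open>
  Each entry of the increasing enumeration is the least live index above the previous entry.
\<close>

lemma measurable_addr: "(\<lambda>x. addr x n) \<in> measurable N (count_space UNIV)"
proof (induction n)
  case 0
  have "(\<lambda>x. LEAST k. k \<in> live x) \<in> measurable N (count_space UNIV)"
    by (rule measurable_Least) (rule pred_live)
  then show ?case by (simp add: addr_def enumerate_0)
next
  case (Suc n)
  have "Measurable.pred N (\<lambda>x. addr x n < k)" for k
    using measurable_compose[OF Suc.IH, of "\<lambda>i. i < k" "count_space UNIV"] by simp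
  then have "Measurable.pred N (\<lambda>x. k \<in> live x \<and> addr x n < k)" for k
    by (rule pred_intros_logic(3)[OF pred_live])
  then have "(\<lambda>x. LEAST k. k \<in> live x \<and> addr x n < k) \<in> measurable N (count_space UNIV)"
    by (rule measurable_Least)
  then show ?case
    by (rule subst[OF measurable_cong, rotated]) (simp add: addr_def enumerate_Suc''[OF infinite_live])
qed

lemma sets_addr: "{x \<in> space N. addr x n = k} \<in> sets N"
  using measurable_sets[OF measurable_addr, of "{k}" n] by (simp add: vimage_def Int_def conj_commute)

text \<open>
  Up to a countable partition according to the indices of the cells that contain the chosen points,
  the question whether a relation holds at enumerated points becomes a question about fixed cells.
\<close>

lemma sets_relation_at_points:
  fixes n :: nat
  assumes Q: "\<And>c. {x \<in> space N. \<exists>v\<in>{..<n} \<rightarrow>\<^sub>E E x. Q x v \<and> (\<forall>i<n. v i \<in> cell (c i))} \<in> sets N"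
  shows "{x \<in> space N. Q x (\<lambda>i\<in>{..<n}. point x (t i))} \<in> sets N"
proof -
  let ?A = "\<lambda>c. {x \<in> space N. \<forall>i\<in>{..<n}. addr x (t i) = c i} \<inter>
    {x \<in> space N. \<exists>v\<in>{..<n} \<rightarrow>\<^sub>E E x. Q x v \<and> (\<forall>i<n. v i \<in> cell (c i))}"
  have "{x \<in> space N. Q x (\<lambda>i\<in>{..<n}. point x (t i))} = (\<Union>c\<in>nat_tuples n. ?A c)" (is "?L = ?R")
  proof (intro equalityI subsetI)
    fix x assume x: "x \<in> ?L"
    let ?v = "\<lambda>i\<in>{..<n}. point x (t i)" and ?c = "\<lambda>i\<in>{..<n}. addr x (t i)"
    have v: "?v \<in> {..<n} \<rightarrow>\<^sub>E E x" "\<forall>i<n. ?v i \<in> cell (?c i)"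
      using x by (auto simp: point_in_cell)
    have "x \<in> ?A ?c"
    proof (intro IntI CollectI conjI)
      show "\<exists>w\<in>{..<n} \<rightarrow>\<^sub>E E x. Q x w \<and> (\<forall>i<n. w i \<in> cell (?c i))"
        using x v by (intro bexI[of _ ?v]) simp_all
    qed (use x in simp_all)
    moreover have "?c \<in> nat_tuples n" by (simp add: nat_tuples_def)
    ultimately show "x \<in> ?R" by blast
  next
    fix x assume "x \<in> ?R"
    then obtain c v where x: "x \<in> space N" and c: "\<forall>i\<in>{..<n}. addr x (t i) = c i"
      and v: "v \<in> {..<n} \<rightarrow>\<^sub>E E x" "Q x v" "\<forall>i<n. v i \<in> cell (c i)" by blast
    have "v i = point x (t i)" if "i < n" for i
      by (rule cell_unique[OF x, of _ _ "c i"]) (use that c v x point_in_cell[OF x, of "t i"] in auto)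
    then have "v = (\<lambda>i\<in>{..<n}. point x (t i))"
      using v(1) by (auto simp: fun_eq_iff PiE_iff extensional_def)
    then show "x \<in> ?L" using v(2) x by simp
  qed
  moreover have "?A c \<in> sets N" for c
    by (intro sets.Int Q sets.sets_Collect_finite_All sets_addr) auto
  then have "(\<Union>c\<in>nat_tuples n. ?A c) \<in> sets N"
    by (intro sets.countable_UN') (auto simp: nat_tuples_def intro!: countable_PiE)
  ultimately show ?thesis by simp
qed

text \<open>
  The same partition argument for a family of maps \<open>\<phi> m\<close> between two members of the family, such as the
  isomorphisms of a groupoid acting on the fibers over their sources and targets.
\<close>

lemma sets_map_at_points:
  assumes s: "s \<in> measurable Q N" and t: "t \<in> measurable Q N"
    and maps: "\<And>m u. m \<in> space Q \<Longrightarrow> u \<in> E (s m) \<Longrightarrow> \<phi> m u \<in> E (t m)"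
    and \<phi>: "\<And>i j. {m \<in> space Q. \<exists>u\<in>E (s m) \<inter> cell i. \<phi> m u \<in> cell j} \<in> sets Q"
  shows "{m \<in> space Q. \<phi> m (point (s m) n) = point (t m) k} \<in> sets Q"
proof -
  let ?A = "\<lambda>i j. (s -` {x \<in> space N. addr x n = i} \<inter> space Q) \<inter>
    ((t -` {x \<in> space N. addr x k = j} \<inter> space Q) \<inter> {m \<in> space Q. \<exists>u\<in>E (s m) \<inter> cell i. \<phi> m u \<in> cell j})"
  have "{m \<in> space Q. \<phi> m (point (s m) n) = point (t m) k} = (\<Union>i. \<Union>j. ?A i j)" (is "?L = ?R")
  proof (intro equalityI subsetI)
    fix m assume m: "m \<in> ?L"
    then have x: "s m \<in> space N" "t m \<in> space N"
      using measurable_space[OF s] measurable_space[OF t] by auto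
    have "\<exists>u\<in>E (s m) \<inter> cell (addr (s m) n). \<phi> m u \<in> cell (addr (t m) k)"
      using m x point_in_cell[OF x(1), of n] point_in_cell[OF x(2), of k] point_in[OF x(1), of n]
      by (intro bexI[of _ "point (s m) n"]) auto
    then have "m \<in> ?A (addr (s m) n) (addr (t m) k)"
      using m x point_in_cell[OF x(1), of n] point_in_cell[OF x(2), of k] point_in[OF x(1), of n] by auto
    then show "m \<in> ?R" by blast
  next
    fix m assume "m \<in> ?R"
    then obtain u where m: "m \<in> space Q" and x: "s m \<in> space N" "t m \<in> space N"
      and u: "u \<in> E (s m)" "u \<in> cell (addr (s m) n)" "\<phi> m u \<in> cell (addr (t m) k)" by blast
    have "u = point (s m) n"
      by (rule cell_unique[OF x(1) u(1) _ u(2)]) (simp_all add: x point_in_cell)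
    moreover have "\<phi> m u = point (t m) k"
      by (rule cell_unique[OF x(2) maps[OF m u(1)] _ u(3)]) (simp_all add: x point_in_cell)
    ultimately show "m \<in> ?L" using m by simp
  qed
  moreover have "?A i j \<in> sets Q" for i j
    by (intro sets.Int \<phi> measurable_sets[OF s] measurable_sets[OF t] sets_addr)
  then have "(\<Union>j. ?A i j) \<in> sets Q" for i by (intro sets.countable_UN) blast
  then have "(\<Union>i. \<Union>j. ?A i j) \<in> sets Q" by (intro sets.countable_UN) blast
  ultimately show ?thesis by simp
qed

end

section \<open>Transporting relations to the natural numbers\<close>

text \<open>
  The set of all symbols \<open>UNIV\<close> appears in the restriction because the structures on the
  natural numbers are extensional functions on the language.
\<close>

definition transport :: "('r \<Rightarrow> nat) \<Rightarrow> ('r \<Rightarrow> (nat \<Rightarrow> 'e) \<Rightarrow> bool) \<Rightarrow> (nat \<Rightarrow> 'e) \<Rightarrow> 'r \<Rightarrow> (nat \<Rightarrow> nat) \<Rightarrow> bool" where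
  "transport ar H e = (\<lambda>R\<in>UNIV. \<lambda>t\<in>nat_tuples (ar R). H R (\<lambda>i\<in>{..<ar R}. e (t i)))"

lemma transport_in: "transport ar H e \<in> topspace (Mod_nat UNIV ar)"
  by (auto simp: topspace_Mod_nat transport_def)

lemma restrict_eq_iff:
  "(\<lambda>R\<in>UNIV. \<lambda>t\<in>T R. A R t) = (\<lambda>R\<in>UNIV. \<lambda>t\<in>T R. B R t) \<longleftrightarrow> (\<forall>R. \<forall>t\<in>T R. A R t = B R t)"
proof
  assume eq: "(\<lambda>R\<in>UNIV. \<lambda>t\<in>T R. A R t) = (\<lambda>R\<in>UNIV. \<lambda>t\<in>T R. B R t)"
  show "\<forall>R. \<forall>t\<in>T R. A R t = B R t"
  proof (intro allI ballI)
    fix R t assume "t \<in> T R"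
    then show "A R t = B R t" using fun_cong[OF fun_cong[OF eq, of R], of t] by simp
  qed
qed (intro restrict_ext, simp)

text \<open>
  The arrows between two transported structures are exactly the conjugates of the relation preserving
  bijections: \<open>g\<close> carries one structure to the other if and only if \<open>e' \<circ> g \<circ> e\<^sup>-\<^sup>1\<close> preserves all
  relations.
\<close>

lemma pushforward_transport_iff:
  assumes e: "bij_betw e UNIV A" and g: "bij g"
  shows "pushforward UNIV ar g (transport ar H e) = transport ar H' e' \<longleftrightarrow>
    (\<forall>R. \<forall>v\<in>{..<ar R} \<rightarrow>\<^sub>E A. H R v \<longleftrightarrow> H' R (\<lambda>i\<in>{..<ar R}. e' (g (inv e (v i)))))"
    (is "?L \<longleftrightarrow> ?R")
proof -
  have inv_e: "inv e (e n) = n" for n using e by (simp add: bij_betw_def)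
  have e_inv: "e (inv e u) = u" if "u \<in> A" for u
    using e that by (metis bij_betw_imp_surj_on f_inv_into_f)
  have g': "inv g (g n) = n" "g (inv g n) = n" for n
    using g by (simp_all add: bij_is_inj bij_is_surj surj_f_inv_f)
  have "?L \<longleftrightarrow> (\<forall>R. \<forall>t\<in>nat_tuples (ar R).
      H R (\<lambda>i\<in>{..<ar R}. e (inv g (t i))) \<longleftrightarrow> H' R (\<lambda>i\<in>{..<ar R}. e' (t i)))"
  proof -
    have "pushforward UNIV ar g (transport ar H e) =
      (\<lambda>R\<in>UNIV. \<lambda>t\<in>nat_tuples (ar R). H R (\<lambda>i\<in>{..<ar R}. e (inv g (t i))))"
      unfolding pushforward_def
    proof (intro restrict_ext)
      fix R and t :: "nat \<Rightarrow> nat"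
      have "(\<lambda>i\<in>{..<ar R}. e ((\<lambda>i\<in>{..<ar R}. inv g (t i)) i)) = (\<lambda>i\<in>{..<ar R}. e (inv g (t i)))"
        by (intro restrict_ext) simp
      moreover have "(\<lambda>i\<in>{..<ar R}. inv g (t i)) \<in> nat_tuples (ar R)" by (simp add: nat_tuples_def)
      ultimately show "transport ar H e R (\<lambda>i\<in>{..<ar R}. inv g (t i)) = H R (\<lambda>i\<in>{..<ar R}. e (inv g (t i)))"
        by (simp add: transport_def)
    qed
    then show ?thesis by (simp only: transport_def restrict_eq_iff)
  qed
  also have "\<dots> \<longleftrightarrow> ?R"
  proof (rule iffI; intro allI ballI)
    fix R v assume H: "\<forall>R. \<forall>t\<in>nat_tuples (ar R).
      H R (\<lambda>i\<in>{..<ar R}. e (inv g (t i))) \<longleftrightarrow> H' R (\<lambda>i\<in>{..<ar R}. e' (t i))"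
      and v: "v \<in> {..<ar R} \<rightarrow>\<^sub>E A"
    let ?t = "\<lambda>i\<in>{..<ar R}. g (inv e (v i))"
    have "(\<lambda>i\<in>{..<ar R}. e (inv g (?t i))) = v"
      using v by (auto simp: fun_eq_iff g' e_inv PiE_iff extensional_def)
    moreover have "(\<lambda>i\<in>{..<ar R}. e' (?t i)) = (\<lambda>i\<in>{..<ar R}. e' (g (inv e (v i))))" by auto
    moreover have "?t \<in> nat_tuples (ar R)" by (simp add: nat_tuples_def)
    ultimately show "H R v \<longleftrightarrow> H' R (\<lambda>i\<in>{..<ar R}. e' (g (inv e (v i))))" using H by metis
  next
    fix R t assume H: ?R and "t \<in> nat_tuples (ar R)"
    let ?v = "\<lambda>i\<in>{..<ar R}. e (inv g (t i))"
    have "?v \<in> {..<ar R} \<rightarrow>\<^sub>E A" using bij_betw_apply[OF e] by simp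
    moreover have "(\<lambda>i\<in>{..<ar R}. e' (g (inv e (?v i)))) = (\<lambda>i\<in>{..<ar R}. e' (t i))"
      by (intro restrict_ext) (simp add: inv_e g')
    ultimately show "H R ?v \<longleftrightarrow> H' R (\<lambda>i\<in>{..<ar R}. e' (t i))" using H by metis
  qed
  finally show ?thesis .
qed

section \<open>Etale spaces and fiber products\<close>

lemma open_section_inverse:
  assumes "open_section X A p S"
  obtains s where "continuous_map (subtopology X (p ` S)) (subtopology A S) s"
    "\<And>a. a \<in> S \<Longrightarrow> s (p a) = a" "openin X (p ` S)" "S \<subseteq> topspace A"
proof -
  have S: "openin A S" and emb: "embedding_map (subtopology A S) X p"
    and op: "open_map (subtopology A S) X p"
    using assms by (auto simp: open_section_def)
  have sub: "S \<subseteq> topspace A" using S by (rule openin_subset)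
  then have top: "topspace (subtopology A S) = S" by auto
  obtain s where "homeomorphic_maps (subtopology A S) (subtopology X (p ` S)) p s"
    using emb unfolding embedding_map_def homeomorphic_map_maps top by blast
  then have "continuous_map (subtopology X (p ` S)) (subtopology A S) s" "\<And>a. a \<in> S \<Longrightarrow> s (p a) = a"
    unfolding homeomorphic_maps_def top by blast+
  moreover have "openin X (p ` S)"
    using op S by (metis open_map_def openin_topspace top)
  ultimately show ?thesis using sub that by blast
qed

lemma open_section_inj: "open_section X A p S \<Longrightarrow> inj_on p S"
  by (metis inj_on_inverseI open_section_inverse)

lemma etale_space_openin_image:
  assumes A: "etale_space X A p" and U: "openin A U"
  shows "openin X (p ` U)"
proof -
  have "openin X (p ` (U \<inter> S))" if "open_section X A p S" for S
    using that U by (auto simp: open_section_def open_map_def openin_subtopology)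
  then have "openin X (\<Union>S\<in>{S. open_section X A p S}. p ` (U \<inter> S))" by blast
  moreover have "p ` U = (\<Union>S\<in>{S. open_section X A p S}. p ` (U \<inter> S))"
    using A openin_subset[OF U] by (fastforce simp: etale_space_def)
  ultimately show ?thesis by simp
qed

lemma topspace_fiber_product:
  "topspace (fiber_product X M w) = {(x, a). x \<in> topspace X \<and> a \<in> tuples (fiber M x) w}"
proof -
  have "(x, a) \<in> topspace (fiber_product X M w) \<longleftrightarrow> x \<in> topspace X \<and> a \<in> tuples (fiber M x) w" for x a
    by (simp add: fiber_product_def tuples_def fiber_def PiE_iff Ball_def) blast
  then show ?thesis by auto
qed

lemma continuous_map_fiber_product_coordinate:
  assumes "i < length w"
  shows "continuous_map (fiber_product X M w) (space_of M (w ! i)) (\<lambda>(x, a). a i)"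
proof -
  have "continuous_map (prod_topology X (product_topology (\<lambda>i. space_of M (w ! i)) {..<length w}))
      (space_of M (w ! i)) ((\<lambda>a. a i) \<circ> snd)"
    using assms continuous_map_product_projection[of i "{..<length w}" "\<lambda>i. space_of M (w ! i)"]
    by (intro continuous_map_compose[OF continuous_map_snd]) simp
  then show ?thesis
    unfolding fiber_product_def by (intro continuous_map_from_subtopology) (simp add: comp_def case_prod_unfold)
qed

lemma continuous_map_into_fiber_product:
  assumes "continuous_map T X f"
    and "\<And>i. i < length w \<Longrightarrow> continuous_map T (space_of M (w ! i)) (\<lambda>z. g z i)"
    and "\<And>z i. z \<in> topspace T \<Longrightarrow> i < length w \<Longrightarrow> proj M (w ! i) (g z i) = f z"
  shows "continuous_map T (fiber_product X M w) (\<lambda>z. (f z, \<lambda>i\<in>{..<length w}. g z i))"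
  unfolding fiber_product_def
proof (rule continuous_map_into_subtopology)
  have "continuous_map T (product_topology (\<lambda>i. space_of M (w ! i)) {..<length w}) (\<lambda>z. \<lambda>i\<in>{..<length w}. g z i)"
    unfolding continuous_map_componentwise using assms(2) by (auto simp: image_subset_iff)
  then show "continuous_map T (prod_topology X (product_topology (\<lambda>i. space_of M (w ! i)) {..<length w}))
      (\<lambda>z. (f z, \<lambda>i\<in>{..<length w}. g z i))"
    using assms(1) by (simp add: continuous_map_pairwise comp_def)
qed (use assms(3) in auto)

lemma continuous_map_fiber_product_restrict:
  "continuous_map (fiber_product X M (w @ v)) (fiber_product X M w) (\<lambda>(x, a). (x, restrict a {..<length w}))"
proof -
  have "continuous_map (fiber_product X M (w @ v)) (fiber_product X M w)
      (\<lambda>z. (fst z, \<lambda>i\<in>{..<length w}. snd z i))"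
  proof (rule continuous_map_into_fiber_product)
    show "continuous_map (fiber_product X M (w @ v)) X fst"
      unfolding fiber_product_def by (intro continuous_map_from_subtopology continuous_map_fst)
  next
    fix i assume "i < length w"
    then show "continuous_map (fiber_product X M (w @ v)) (space_of M (w ! i)) (\<lambda>z. snd z i)"
      using continuous_map_fiber_product_coordinate[of i "w @ v" X M]
      by (simp add: nth_append case_prod_unfold)
  next
    fix z i assume z: "z \<in> topspace (fiber_product X M (w @ v))" and i: "i < length w"
    have "\<forall>j<length (w @ v). proj M ((w @ v) ! j) (snd z j) = fst z"
      using z by (simp add: fiber_product_def case_prod_unfold)
    from spec[OF this, of i] show "proj M (w ! i) (snd z i) = fst z"
      using i by (simp add: nth_append)
  qed
  then show ?thesis by (simp add: case_prod_unfold)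
qed

text \<open>
  Through any point of the fiber product passes a continuous local section of the projection, namely
  the tuple of the inverses of open sections through its coordinates.  It pulls a neighborhood of the
  point back to a neighborhood of the base point.
\<close>

lemma openin_fiber_product_projection:
  fixes M :: "('s, 'r, 'f, 'x, 'a) etale_data"
  assumes et: "\<And>i. i < length w \<Longrightarrow> etale_space X (space_of M (w ! i)) (proj M (w ! i))"
    and W: "openin (fiber_product X M w) W"
  shows "openin X (fst ` W)"
proof (subst openin_subopen, intro ballI)
  fix x assume "x \<in> fst ` W"
  then obtain a where xa: "(x, a) \<in> W" by auto
  let ?n = "length w"
  have x: "x \<in> topspace X" and a: "a \<in> extensional {..<?n}"
    using openin_subset[OF W] xa by (auto simp: fiber_product_def PiE_iff)
  have ai: "a i \<in> topspace (space_of M (w ! i))" "proj M (w ! i) (a i) = x" if "i < ?n" for i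
    using openin_subset[OF W] xa that by (auto simp: fiber_product_def PiE_iff)
  have "\<exists>S. open_section X (space_of M (w ! i)) (proj M (w ! i)) S \<and> a i \<in> S" if "i < ?n" for i
    using et[OF that] ai(1)[OF that] by (auto simp: etale_space_def)
  then obtain S where S: "\<And>i. i < ?n \<Longrightarrow> open_section X (space_of M (w ! i)) (proj M (w ! i)) (S i)"
      "\<And>i. i < ?n \<Longrightarrow> a i \<in> S i"
    by metis
  have "\<exists>s. continuous_map (subtopology X (proj M (w ! i) ` S i)) (subtopology (space_of M (w ! i)) (S i)) s \<and>
      (\<forall>b\<in>S i. s (proj M (w ! i) b) = b) \<and> openin X (proj M (w ! i) ` S i)" if "i < ?n" for i
    by (rule open_section_inverse[OF S(1)[OF that]]) blast
  then obtain s where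
      s: "\<And>i. i < ?n \<Longrightarrow> continuous_map (subtopology X (proj M (w ! i) ` S i)) (subtopology (space_of M (w ! i)) (S i)) (s i)"
      "\<And>i b. i < ?n \<Longrightarrow> b \<in> S i \<Longrightarrow> s i (proj M (w ! i) b) = b"
      "\<And>i. i < ?n \<Longrightarrow> openin X (proj M (w ! i) ` S i)"
    by metis
  \<comment> \<open>The intersection is \<open>UNIV\<close> for the empty tuple, whence the explicit \<open>topspace X\<close>.\<close>
  define V where "V = topspace X \<inter> (\<Inter>i<?n. proj M (w ! i) ` S i)"
  have V: "openin X V"
    unfolding V_def
    by (cases "?n = 0") (auto intro!: openin_Int openin_INT2 s(3))
  have "continuous_map (subtopology X V) (fiber_product X M w) (\<lambda>z. (z, \<lambda>i\<in>{..<?n}. s i z))"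
    (is "continuous_map _ _ ?\<tau>")
  proof (rule continuous_map_into_fiber_product)
    show "continuous_map (subtopology X V) X (\<lambda>z. z)"
      by (intro continuous_map_from_subtopology) simp
  next
    fix i assume i: "i < ?n"
    have "continuous_map (subtopology X V) (subtopology (space_of M (w ! i)) (S i)) (s i)"
      using s(1)[OF i] by (rule continuous_map_from_subtopology_mono) (use i in \<open>auto simp: V_def\<close>)
    then show "continuous_map (subtopology X V) (space_of M (w ! i)) (s i)"
      by (simp add: continuous_map_in_subtopology)
  next
    fix z i assume "z \<in> topspace (subtopology X V)" and i: "i < ?n"
    then have "z \<in> proj M (w ! i) ` S i" by (auto simp: V_def)
    then show "proj M (w ! i) (s i z) = z" using s(2)[OF i] by auto
  qed
  then have "openin (subtopology X V) {z \<in> topspace (subtopology X V). ?\<tau> z \<in> W}"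
    using W by (rule openin_continuous_map_preimage)
  then have "openin X {z \<in> topspace (subtopology X V). ?\<tau> z \<in> W}"
    using openin_open_subtopology[OF V] by blast
  moreover have "x \<in> {z \<in> topspace (subtopology X V). ?\<tau> z \<in> W}"
  proof -
    have "s i x = a i" if "i < ?n" for i using s(2)[OF that S(2)[OF that]] ai(2)[OF that] by simp
    then have "?\<tau> x = (x, a)" using a by (auto simp: extensional_def fun_eq_iff)
    moreover have "x \<in> V"
      using x ai(2) S(2) by (force simp: V_def)
    ultimately show ?thesis using x xa by simp
  qed
  moreover have "{z \<in> topspace (subtopology X V). ?\<tau> z \<in> W} \<subseteq> fst ` W" by force
  ultimately show "\<exists>T. openin X T \<and> x \<in> T \<and> T \<subseteq> fst ` W" by blast
qed

text \<open>
  An open section contains at most one point over each base point, so two maps over the base agree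
  wherever both take values in the same open section, and this is an open condition.
\<close>

lemma openin_equalizer_over_etale:
  assumes A: "etale_space X A p"
    and f: "continuous_map T A f" and g: "continuous_map T A g"
    and over: "\<And>z. z \<in> topspace T \<Longrightarrow> p (f z) = p (g z)"
  shows "openin T {z \<in> topspace T. f z = g z}"
proof -
  have "{z \<in> topspace T. f z = g z} =
    (\<Union>S\<in>{S. open_section X A p S}. {z \<in> topspace T. f z \<in> S} \<inter> {z \<in> topspace T. g z \<in> S})" (is "?L = ?R")
  proof (intro equalityI subsetI)
    fix z assume z: "z \<in> ?L"
    then have "f z \<in> topspace A" using continuous_map_image_subset_topspace[OF f] by blast
    then obtain S where "open_section X A p S" "f z \<in> S" using A by (auto simp: etale_space_def)
    then show "z \<in> ?R" using z by auto
  next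
    fix z assume "z \<in> ?R"
    then show "z \<in> ?L" using over open_section_inj by (fastforce dest: inj_onD)
  qed
  moreover have "openin T {z \<in> topspace T. h z \<in> S}" if "continuous_map T A h" "open_section X A p S" for h S
    using that by (auto simp: open_section_def intro: openin_continuous_map_preimage)
  then have "openin T ?R" using f g by blast
  ultimately show ?thesis by simp
qed

section \<open>Multi-sorted structures as single-sorted relational structures\<close>

text \<open>
  The single-sorted language: a name for each added natural number, a predicate for each sort, the given
  relation symbols, and a symbol for the graph of each operation.
\<close>

datatype ('s, 'r, 'f) symbol = Nat_sym nat | Sort_sym 's | Rel_sym 'r | Graph_sym 'f

text \<open>
  The added natural numbers belong to no sort, so their names get the empty list here and an empty
  interpretation below; they are treated separately in \<open>holds\<close>.
\<close>

fun sym_sorts :: "('s, 'r, 'f) language \<Rightarrow> ('s, 'r, 'f) symbol \<Rightarrow> 's list" where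
  "sym_sorts L (Nat_sym n) = []"
| "sym_sorts L (Sort_sym P) = [P]"
| "sym_sorts L (Rel_sym R) = rel_arity L R"
| "sym_sorts L (Graph_sym f) = fun_arity L f @ [fun_sort L f]"

fun interp :: "('s, 'r, 'f) language \<Rightarrow> ('s, 'r, 'f, 'a) fo_structure \<Rightarrow> ('s, 'r, 'f) symbol \<Rightarrow> (nat \<Rightarrow> 'a) set" where
  "interp L A (Nat_sym n) = {}"
| "interp L A (Sort_sym P) = tuples A [P]"
| "interp L A (Rel_sym R) = rel A R \<inter> tuples A (rel_arity L R)"
| "interp L A (Graph_sym f) = {a \<in> tuples A (fun_arity L f @ [fun_sort L f]).
     op A f (restrict a {..<length (fun_arity L f)}) = a (length (fun_arity L f))}"

definition symbols :: "('s, 'r, 'f) language \<Rightarrow> ('s, 'r, 'f) symbol set" where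
  "symbols L = range Nat_sym \<union> Sort_sym ` sorts L \<union> Rel_sym ` rels L \<union> Graph_sym ` funs L"

lemma interp_subset: "interp L A \<sigma> \<subseteq> tuples A (sym_sorts L \<sigma>)"
  by (cases \<sigma>) auto

lemma sym_sorts_subset: "language L \<Longrightarrow> \<sigma> \<in> symbols L \<Longrightarrow> set (sym_sorts L \<sigma>) \<subseteq> sorts L"
  by (fastforce simp: symbols_def language_def)

lemma restrict_tuple_append: "a \<in> tuples A (w @ v) \<Longrightarrow> restrict a {..<length w} \<in> tuples A w"
  by (auto simp: tuples_def PiE_iff nth_append split: if_splits)

text \<open>
  For a bijection, commuting with an operation is the same as preserving and reflecting its graph; one
  direction uses that \<open>h\<close> is injective on the sort of the values, the other applies the hypothesis to a
  tuple extended by the value of the operation.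
\<close>

lemma structure_iso_iff_interp:
  assumes L: "language L"
    and op: "\<And>f a. f \<in> funs L \<Longrightarrow> a \<in> tuples A (fun_arity L f) \<Longrightarrow> op A f a \<in> carr A (fun_sort L f)"
    and bij: "\<And>P. P \<in> sorts L \<Longrightarrow> bij_betw (h P) (carr A P) (carr B P)"
  shows "structure_iso L A B h \<longleftrightarrow>
    (\<forall>\<sigma>\<in>symbols L. \<forall>a\<in>tuples A (sym_sorts L \<sigma>).
       a \<in> interp L A \<sigma> \<longleftrightarrow> map_tuple h (sym_sorts L \<sigma>) a \<in> interp L B \<sigma>)" (is "_ \<longleftrightarrow> ?R")
proof
  have h: "\<forall>P\<in>sorts L. h P \<in> carr A P \<rightarrow> carr B P" using bij by (auto simp: bij_betw_def)
  have graph: "map_tuple h (fun_arity L f @ [fun_sort L f]) a \<in> interp L B (Graph_sym f) \<longleftrightarrow>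
      op B f (map_tuple h (fun_arity L f) (restrict a {..<length (fun_arity L f)}))
        = h (fun_sort L f) (a (length (fun_arity L f)))"
    if "f \<in> funs L" "a \<in> tuples A (fun_arity L f @ [fun_sort L f])" for f a
  proof -
    let ?w = "fun_arity L f"
    have "restrict (map_tuple h (?w @ [fun_sort L f]) a) {..<length ?w} = map_tuple h ?w (restrict a {..<length ?w})"
      by (auto simp: map_tuple_def nth_append)
    moreover have "map_tuple h (?w @ [fun_sort L f]) a (length ?w) = h (fun_sort L f) (a (length ?w))"
      by (simp add: map_tuple_def)
    moreover have "map_tuple h (?w @ [fun_sort L f]) a \<in> tuples B (?w @ [fun_sort L f])"
      using L that by (intro map_tuple_in[OF h]) (auto simp: language_def)
    ultimately show ?thesis by simp
  qed
  have tuple: "map_tuple h (rel_arity L R) a \<in> tuples B (rel_arity L R)"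
    if "R \<in> rels L" "a \<in> tuples A (rel_arity L R)" for R a
    using L that by (intro map_tuple_in[OF h]) (auto simp: language_def)
  {
    assume iso: "structure_iso L A B h"
    show ?R
    proof (intro ballI)
      fix \<sigma> a assume \<sigma>: "\<sigma> \<in> symbols L" and a: "a \<in> tuples A (sym_sorts L \<sigma>)"
      show "a \<in> interp L A \<sigma> \<longleftrightarrow> map_tuple h (sym_sorts L \<sigma>) a \<in> interp L B \<sigma>"
      proof (cases \<sigma>)
        case (Sort_sym P)
        then have "P \<in> sorts L" using \<sigma> by (auto simp: symbols_def)
        then have "map_tuple h [P] a \<in> tuples B [P]"
          using a Sort_sym by (intro map_tuple_in[OF h]) auto
        then show ?thesis using a Sort_sym by simp
      next
        case (Rel_sym R)
        then have "R \<in> rels L" using \<sigma> by (auto simp: symbols_def)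
        then show ?thesis using iso a tuple Rel_sym by (auto simp: structure_iso_def)
      next
        case (Graph_sym f)
        let ?w = "fun_arity L f" and ?Q = "fun_sort L f"
        have f: "f \<in> funs L" using \<sigma> Graph_sym by (auto simp: symbols_def)
        then have Q: "?Q \<in> sorts L" using L by (auto simp: language_def)
        have a': "a \<in> tuples A (?w @ [?Q])" using a Graph_sym by simp
        let ?a = "restrict a {..<length ?w}"
        have ta: "?a \<in> tuples A ?w" using a' by (rule restrict_tuple_append)
        have "a (length ?w) \<in> carr A ?Q" using a' by (auto simp: tuples_def PiE_iff dest!: bspec[of _ _ "length ?w"])
        then have "op A f ?a = a (length ?w) \<longleftrightarrow> h ?Q (op A f ?a) = h ?Q (a (length ?w))"
          using op[OF f ta] bij[OF Q] by (auto simp: bij_betw_def dest: inj_onD)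
        also have "h ?Q (op A f ?a) = op B f (map_tuple h ?w ?a)"
          using iso f ta by (simp add: structure_iso_def)
        finally have "op A f ?a = a (length ?w) \<longleftrightarrow> op B f (map_tuple h ?w ?a) = h ?Q (a (length ?w))" .
        moreover have "a \<in> interp L A (Graph_sym f) \<longleftrightarrow> op A f ?a = a (length ?w)" using a' by simp
        ultimately show ?thesis using graph[OF f a'] unfolding Graph_sym sym_sorts.simps by blast
      qed simp
    qed
  next
    assume R: ?R
    show "structure_iso L A B h"
      unfolding structure_iso_def
    proof (intro conjI ballI)
      fix R a assume "R \<in> rels L" "a \<in> tuples A (rel_arity L R)"
      then show "a \<in> rel A R \<longleftrightarrow> map_tuple h (rel_arity L R) a \<in> rel B R"
        using R[rule_format, of "Rel_sym R" a] tuple by (simp add: symbols_def)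
    next
      fix f a assume f: "f \<in> funs L" and a: "a \<in> tuples A (fun_arity L f)"
      let ?w = "fun_arity L f" and ?Q = "fun_sort L f"
      \<comment> \<open>The point of the graph of the operation over the argument tuple \<open>a\<close>.\<close>
      let ?b = "\<lambda>i. if i = length ?w then op A f a else a i"
      have b: "?b \<in> tuples A (?w @ [?Q])"
        using op[OF f a] a by (auto simp: tuples_def PiE_iff nth_append extensional_def)
      have r: "restrict ?b {..<length ?w} = a"
        using a by (auto simp: tuples_def PiE_iff extensional_def fun_eq_iff)
      have "?b \<in> interp L A (Graph_sym f)" using b r by simp
      then have "map_tuple h (?w @ [?Q]) ?b \<in> interp L B (Graph_sym f)"
        using R[rule_format, of "Graph_sym f" ?b] b f by (simp add: symbols_def)
      then show "h ?Q (op A f a) = op B f (map_tuple h ?w a)"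
        using graph[OF f b] by (simp only: r) simp
    qed (rule bij)
  }
qed

text \<open>
  The added copy of the natural numbers makes this set infinite; the tag \<open>P\<close> keeps sorts apart whose
  carriers overlap.
\<close>

definition points :: "('s, 'r, 'f) language \<Rightarrow> ('s, 'r, 'f, 'a) fo_structure \<Rightarrow> (nat + 's \<times> 'a) set" where
  "points L A = range Inl \<union> Inr ` Sigma (sorts L) (carr A)"

definition lift :: "('s \<Rightarrow> 'a \<Rightarrow> 'b) \<Rightarrow> nat + 's \<times> 'a \<Rightarrow> nat + 's \<times> 'b" where
  "lift h = map_sum id (\<lambda>(P, a). (P, h P a))"

lemma lift_simps [simp]: "lift h (Inl n) = Inl n" "lift h (Inr (P, a)) = Inr (P, h P a)"
  by (simp_all add: lift_def)

lemma points_simps [simp]: "Inl n \<in> points L A" "Inr (P, a) \<in> points L A \<longleftrightarrow> P \<in> sorts L \<and> a \<in> carr A P"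
  by (auto simp: points_def)

lemma points_cases:
  assumes "u \<in> points L A"
  obtains n where "u = Inl n" | P a where "u = Inr (P, a)" "P \<in> sorts L" "a \<in> carr A P"
  using assms unfolding points_def by blast

lemma bij_betw_lift:
  assumes "\<And>P. P \<in> sorts L \<Longrightarrow> bij_betw (h P) (carr A P) (carr B P)"
  shows "bij_betw (lift h) (points L A) (points L B)"
proof (rule bij_betwI')
  fix u v assume "u \<in> points L A" "v \<in> points L A"
  then show "(lift h u = lift h v) = (u = v)"
    by (elim points_cases) (use assms in \<open>auto simp: bij_betw_def dest: inj_onD\<close>)
next
  fix u assume "u \<in> points L A"
  then show "lift h u \<in> points L B"
    by (elim points_cases) (use assms in \<open>auto dest: bij_betwE\<close>)
next
  fix u assume "u \<in> points L B"
  then show "\<exists>v\<in>points L A. u = lift h v"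
  proof (cases rule: points_cases)
    case (1 n)
    then show ?thesis by (intro bexI[of _ "Inl n"]) auto
  next
    case (2 P b)
    then obtain a where "a \<in> carr A P" "h P a = b" using assms by (metis bij_betw_iff_bijections)
    then show ?thesis using 2 by (intro bexI[of _ "Inr (P, a)"]) auto
  qed
qed

definition tagged :: "'s list \<Rightarrow> (nat \<Rightarrow> 'a) \<Rightarrow> nat \<Rightarrow> nat + 's \<times> 'a" where
  "tagged w a = (\<lambda>i\<in>{..<length w}. Inr (w ! i, a i))"

lemma tagged_inj: "a \<in> tuples A w \<Longrightarrow> b \<in> tuples B w \<Longrightarrow> tagged w a = tagged w b \<longleftrightarrow> a = b"
  unfolding tagged_def tuples_def PiE_iff
  by (auto simp: fun_eq_iff extensional_def restrict_def split: if_splits) metis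

lemma tagged_in_points: "a \<in> tuples A w \<Longrightarrow> set w \<subseteq> sorts L \<Longrightarrow> tagged w a \<in> {..<length w} \<rightarrow>\<^sub>E points L A"
  by (auto simp: tagged_def tuples_def PiE_iff)

lemma lift_tagged: "(\<lambda>i\<in>{..<length w}. lift h (tagged w a i)) = tagged w (map_tuple h w a)"
  by (auto simp: tagged_def map_tuple_def)

definition sym_arity :: "('s, 'r, 'f) language \<Rightarrow> ('s, 'r, 'f) symbol \<Rightarrow> nat" where
  "sym_arity L \<sigma> = (case \<sigma> of Nat_sym n \<Rightarrow> 1 | _ \<Rightarrow> length (sym_sorts L \<sigma>))"

text \<open>
  Apart from the names of numbers, a symbol can hold only for tuples whose entries all lie in the sorts
  required by the symbol.
\<close>

definition holds :: "('s, 'r, 'f) language \<Rightarrow> ('s, 'r, 'f, 'a) fo_structure \<Rightarrow> ('s, 'r, 'f) symbol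
    \<Rightarrow> (nat \<Rightarrow> nat + 's \<times> 'a) \<Rightarrow> bool" where
  "holds L A \<sigma> v \<longleftrightarrow> (case \<sigma> of Nat_sym n \<Rightarrow> v 0 = Inl n | _ \<Rightarrow> v \<in> tagged (sym_sorts L \<sigma>) ` interp L A \<sigma>)"

lemma holds_Nat_sym [simp]: "holds L A (Nat_sym n) v \<longleftrightarrow> v 0 = Inl n" "sym_arity L (Nat_sym n) = 1"
  by (simp_all add: holds_def sym_arity_def)

lemma holds_other:
  assumes "\<And>n. \<sigma> \<noteq> Nat_sym n"
  shows "holds L A \<sigma> v \<longleftrightarrow> v \<in> tagged (sym_sorts L \<sigma>) ` interp L A \<sigma>"
    "sym_arity L \<sigma> = length (sym_sorts L \<sigma>)"
  using assms by (cases \<sigma>; simp add: holds_def sym_arity_def)+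

lemma holds_tagged:
  assumes "\<And>n. \<sigma> \<noteq> Nat_sym n" "a \<in> tuples A (sym_sorts L \<sigma>)"
  shows "holds L A \<sigma> (tagged (sym_sorts L \<sigma>) a) \<longleftrightarrow> a \<in> interp L A \<sigma>"
  using assms interp_subset[of L A \<sigma>] tagged_inj[OF assms(2)]
  by (auto simp: holds_other) 

definition preserves_symbols ::
  "('s, 'r, 'f) language \<Rightarrow> ('s, 'r, 'f, 'a) fo_structure \<Rightarrow> ('s, 'r, 'f, 'b) fo_structure
    \<Rightarrow> (nat + 's \<times> 'a \<Rightarrow> nat + 's \<times> 'b) \<Rightarrow> bool" where
  "preserves_symbols L A B \<phi> \<longleftrightarrow> (\<forall>\<sigma>\<in>symbols L. \<forall>v\<in>{..<sym_arity L \<sigma>} \<rightarrow>\<^sub>E points L A.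
     holds L A \<sigma> v \<longleftrightarrow> holds L B \<sigma> (\<lambda>i\<in>{..<sym_arity L \<sigma>}. \<phi> (v i)))"

lemma preserves_symbols_cong:
  assumes "\<And>u. u \<in> points L A \<Longrightarrow> \<phi> u = \<psi> u"
  shows "preserves_symbols L A B \<phi> \<longleftrightarrow> preserves_symbols L A B \<psi>"
proof -
  have "(\<lambda>i\<in>{..<n}. \<phi> (v i)) = (\<lambda>i\<in>{..<n}. \<psi> (v i))"
    if "v \<in> {..<n} \<rightarrow>\<^sub>E points L A" for v and n :: nat
    by (rule restrict_ext) (use that assms in auto)
  then show ?thesis unfolding preserves_symbols_def by simp
qed

text \<open>
  A tuple of points whose image under \<open>lift h\<close> has entries of prescribed sorts has itself entries of
  these sorts, since \<open>lift h\<close> keeps the tags.  Hence the relations on points are determined by those on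
  tuples in the sorts, where \<open>structure_iso_iff_interp\<close> applies.
\<close>

lemma preserves_symbols_lift:
  assumes L: "language L"
    and op: "\<And>f a. f \<in> funs L \<Longrightarrow> a \<in> tuples A (fun_arity L f) \<Longrightarrow> op A f a \<in> carr A (fun_sort L f)"
    and bij: "\<And>P. P \<in> sorts L \<Longrightarrow> bij_betw (h P) (carr A P) (carr B P)"
  shows "preserves_symbols L A B (lift h) \<longleftrightarrow> structure_iso L A B h"
proof
  have h: "\<forall>P\<in>sorts L. h P \<in> carr A P \<rightarrow> carr B P" using bij by (auto simp: bij_betw_def)
  have iff: "structure_iso L A B h \<longleftrightarrow> (\<forall>\<sigma>\<in>symbols L. \<forall>a\<in>tuples A (sym_sorts L \<sigma>).
       a \<in> interp L A \<sigma> \<longleftrightarrow> map_tuple h (sym_sorts L \<sigma>) a \<in> interp L B \<sigma>)"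
    by (intro structure_iso_iff_interp L op bij)
  {
    assume pres: "preserves_symbols L A B (lift h)"
    show "structure_iso L A B h"
      unfolding iff
    proof (intro ballI)
      fix \<sigma> a assume \<sigma>: "\<sigma> \<in> symbols L" and a: "a \<in> tuples A (sym_sorts L \<sigma>)"
      let ?w = "sym_sorts L \<sigma>"
      show "a \<in> interp L A \<sigma> \<longleftrightarrow> map_tuple h ?w a \<in> interp L B \<sigma>"
      proof (cases "\<exists>n. \<sigma> = Nat_sym n")
        case False
        then have n: "\<And>n. \<sigma> \<noteq> Nat_sym n" by blast
        have w: "set ?w \<subseteq> sorts L" using sym_sorts_subset[OF L \<sigma>] .
        have "holds L A \<sigma> (tagged ?w a) \<longleftrightarrow> holds L B \<sigma> (\<lambda>i\<in>{..<length ?w}. lift h (tagged ?w a i))"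
          using pres \<sigma> tagged_in_points[OF a w]
          unfolding preserves_symbols_def holds_other(2)[OF n, symmetric] by blast
        then show ?thesis
          unfolding lift_tagged holds_tagged[OF n a] holds_tagged[OF n map_tuple_in[OF h w a]] .
      qed auto
    qed
  next
    assume iso: "structure_iso L A B h"
    show "preserves_symbols L A B (lift h)"
      unfolding preserves_symbols_def
    proof (intro ballI)
      fix \<sigma> v assume \<sigma>: "\<sigma> \<in> symbols L" and v: "v \<in> {..<sym_arity L \<sigma>} \<rightarrow>\<^sub>E points L A"
      let ?v = "\<lambda>i\<in>{..<sym_arity L \<sigma>}. lift h (v i)"
      show "holds L A \<sigma> v \<longleftrightarrow> holds L B \<sigma> ?v"
      proof (cases "\<exists>n. \<sigma> = Nat_sym n")
        case True
        then show ?thesis by (cases "v 0") (auto simp: lift_def)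
      next
        case False
        then have n: "\<And>n. \<sigma> \<noteq> Nat_sym n" by blast
        let ?w = "sym_sorts L \<sigma>"
        have w: "set ?w \<subseteq> sorts L" using sym_sorts_subset[OF L \<sigma>] .
        note ar = holds_other(2)[OF n, of L]
        have interp: "a \<in> interp L A \<sigma> \<longleftrightarrow> map_tuple h ?w a \<in> interp L B \<sigma>" if "a \<in> tuples A ?w" for a
          using iso \<sigma> that unfolding iff by blast
        show ?thesis
        proof
          assume "holds L A \<sigma> v"
          then obtain a where a: "a \<in> interp L A \<sigma>" "v = tagged ?w a" by (auto simp: holds_other(1)[OF n])
          then have "map_tuple h ?w a \<in> interp L B \<sigma>" using interp interp_subset by blast
          then show "holds L B \<sigma> ?v"
            unfolding a(2) ar lift_tagged holds_other(1)[OF n] by (rule imageI)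
        next
          assume "holds L B \<sigma> ?v"
          then obtain b where b: "b \<in> interp L B \<sigma>" "?v = tagged ?w b" by (auto simp: holds_other(1)[OF n])
          have "\<exists>a\<in>carr A (?w ! i). v i = Inr (?w ! i, a)" if i: "i < length ?w" for i
          proof -
            have "lift h (v i) = Inr (?w ! i, b i)"
              using fun_cong[OF b(2), of i] i by (simp add: ar tagged_def)
            moreover have "v i \<in> points L A" using v i by (auto simp: ar PiE_iff)
            ultimately show ?thesis by (auto elim!: points_cases)
          qed
          then obtain a where a: "\<And>i. i < length ?w \<Longrightarrow> a i \<in> carr A (?w ! i) \<and> v i = Inr (?w ! i, a i)"
            by metis
          let ?a = "\<lambda>i\<in>{..<length ?w}. a i"
          have ta: "?a \<in> tuples A ?w" using a by (simp add: tuples_def)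
          have va: "v = tagged ?w ?a"
            using v a by (auto simp: tagged_def ar PiE_iff extensional_def fun_eq_iff)
          have "tagged ?w (map_tuple h ?w ?a) = tagged ?w b"
            using b(2) unfolding va ar lift_tagged .
          then have "map_tuple h ?w ?a = b"
            using tagged_inj[OF map_tuple_in[OF h w ta], of b B] b(1) interp_subset by blast
          then have "?a \<in> interp L A \<sigma>" using interp[OF ta] b(1) by simp
          then show "holds L A \<sigma> v" unfolding va holds_tagged[OF n ta] .
        qed
      qed
    qed
  }
qed

text \<open>
  The names of the numbers and the predicates for the sorts force every symbol preserving bijection to be
  the identity on the added numbers and to respect the sorts, which leaves one bijection per sort.  This
  is where fullness of the functor comes from.
\<close>

lemma preserves_symbols_imp_lift:
  assumes bij: "bij_betw \<phi> (points L A) (points L B)" and pres: "preserves_symbols L A B \<phi>"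
  shows "\<exists>h\<in>\<Pi>\<^sub>E P\<in>sorts L. extensional (carr A P).
    (\<forall>P\<in>sorts L. bij_betw (h P) (carr A P) (carr B P)) \<and> (\<forall>u\<in>points L A. \<phi> u = lift h u)"
proof -
  have nat: "\<phi> (Inl n) = Inl n" for n
  proof -
    have "holds L A (Nat_sym n) v \<longleftrightarrow> holds L B (Nat_sym n) (\<lambda>i\<in>{..<1}. \<phi> (v i))"
      if "v \<in> {..<1} \<rightarrow>\<^sub>E points L A" for v
      using pres that unfolding preserves_symbols_def
      by (metis UnI1 holds_Nat_sym(2) rangeI symbols_def)
    from this[of "\<lambda>i\<in>{..<1}. Inl n"] show ?thesis by simp
  qed
  have sort: "\<exists>b\<in>carr B P. \<phi> (Inr (P, a)) = Inr (P, b)" if P: "P \<in> sorts L" and a: "a \<in> carr A P" for P a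
  proof -
    let ?v = "tagged [P] (\<lambda>i\<in>{..<1::nat}. a)"
    have t: "(\<lambda>i\<in>{..<1::nat}. a) \<in> tuples A [P]" using a by (simp add: tuples_def)
    have "?v \<in> {..<sym_arity L (Sort_sym P)} \<rightarrow>\<^sub>E points L A"
      using tagged_in_points[OF t, of L] P by (simp add: sym_arity_def)
    moreover have "Sort_sym P \<in> symbols L" using P by (simp add: symbols_def)
    moreover have "holds L A (Sort_sym P) ?v" using holds_tagged[of "Sort_sym P" "\<lambda>i\<in>{..<1::nat}. a" A L] t by simp
    ultimately have "holds L B (Sort_sym P) (\<lambda>i\<in>{..<sym_arity L (Sort_sym P)}. \<phi> (?v i))"
      using pres unfolding preserves_symbols_def by blast
    then obtain b where b: "b \<in> tuples B [P]" "(\<lambda>i\<in>{..<1}. \<phi> (?v i)) = tagged [P] b"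
      by (auto simp: holds_other sym_arity_def)
    have "\<phi> (?v 0) = tagged [P] b 0" using fun_cong[OF b(2), of 0] by simp
    then have "\<phi> (Inr (P, a)) = Inr (P, b 0)" by (simp add: tagged_def)
    moreover have "b 0 \<in> carr B P" using PiE_mem[of b "{..<length [P]}" "\<lambda>i. carr B ([P] ! i)" 0] b(1)
      by (simp add: tuples_def)
    ultimately show ?thesis by blast
  qed
  then obtain k where k: "\<And>P a. P \<in> sorts L \<Longrightarrow> a \<in> carr A P \<Longrightarrow> k P a \<in> carr B P \<and> \<phi> (Inr (P, a)) = Inr (P, k P a)"
    by metis
  let ?h = "\<lambda>P\<in>sorts L. \<lambda>a\<in>carr A P. k P a"
  have \<phi>: "\<phi> u = lift ?h u" if "u \<in> points L A" for u
    using that by (cases rule: points_cases) (simp_all add: nat k)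
  have "bij_betw (?h P) (carr A P) (carr B P)" if P: "P \<in> sorts L" for P
  proof (rule bij_betwI')
    fix a a' assume a: "a \<in> carr A P" "a' \<in> carr A P"
    have "\<phi> (Inr (P, a)) = \<phi> (Inr (P, a')) \<longleftrightarrow> a = a'"
      using bij a P inj_on_eq_iff[of \<phi> "points L A" "Inr (P, a)" "Inr (P, a')"] by (simp add: bij_betw_def)
    then show "(?h P a = ?h P a') = (a = a')" using k P a by simp
  next
    fix a assume "a \<in> carr A P" then show "?h P a \<in> carr B P" using k P by simp
  next
    fix b assume "b \<in> carr B P"
    then have "Inr (P, b) \<in> points L B" using P by simp
    then obtain u where u: "u \<in> points L A" "Inr (P, b) = \<phi> u" using bij_betw_imp_surj_on[OF bij] by (metis imageE)
    then show "\<exists>a\<in>carr A P. b = ?h P a"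
      by (cases rule: points_cases) (auto simp: nat k)
  qed
  then show ?thesis using \<phi> by (intro bexI[of _ ?h]) auto
qed

section \<open>Openness of the relations, the cells and the isomorphisms\<close>

text \<open>
  For graphs of operations this is the openness of an equalizer: the value of the operation and the last
  coordinate are two continuous maps into the sort of the values.
\<close>

lemma openin_interp:
  assumes M: "etale_structure L X M" and \<sigma>: "\<sigma> \<in> symbols L"
  shows "openin (fiber_product X M (sym_sorts L \<sigma>)) {(x, a). x \<in> topspace X \<and> a \<in> interp L (fiber M x) \<sigma>}"
proof (cases \<sigma>)
  case (Nat_sym n)
  then show ?thesis by simp
next
  case (Sort_sym P)
  then show ?thesis using openin_topspace[of "fiber_product X M [P]"] by (simp add: topspace_fiber_product)
next
  case (Rel_sym R)
  then have R: "openin (fiber_product X M (rel_arity L R)) (erel M R)"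
    using \<sigma> M by (auto simp: symbols_def etale_structure_def)
  have "erel M R = {(x, a). x \<in> topspace X \<and> a \<in> interp L (fiber M x) \<sigma>}"
    using openin_subset[OF R] by (auto simp: topspace_fiber_product Rel_sym fiber_def)
  then show ?thesis using R by (simp add: Rel_sym)
next
  case (Graph_sym f)
  let ?w = "fun_arity L f" and ?Q = "fun_sort L f"
  have f: "f \<in> funs L" using \<sigma> Graph_sym by (auto simp: symbols_def)
  then have Q: "etale_space X (space_of M ?Q) (proj M ?Q)"
    and op: "continuous_map (fiber_product X M ?w) (space_of M ?Q) (eop M f)"
    and over: "\<And>x a. (x, a) \<in> topspace (fiber_product X M ?w) \<Longrightarrow> proj M ?Q (eop M f (x, a)) = x"
    using M by (auto simp: etale_structure_def language_def)
  let ?T = "fiber_product X M (?w @ [?Q])"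
  have "openin ?T {z \<in> topspace ?T. (eop M f \<circ> (\<lambda>(x, a). (x, restrict a {..<length ?w}))) z = (\<lambda>(x, a). a (length ?w)) z}"
  proof (rule openin_equalizer_over_etale[OF Q])
    show "continuous_map ?T (space_of M ?Q) (eop M f \<circ> (\<lambda>(x, a). (x, restrict a {..<length ?w})))"
      by (rule continuous_map_compose[OF continuous_map_fiber_product_restrict op])
    show "continuous_map ?T (space_of M ?Q) (\<lambda>(x, a). a (length ?w))"
      using continuous_map_fiber_product_coordinate[of "length ?w" "?w @ [?Q]" X M] by simp
    fix z assume "z \<in> topspace ?T"
    then obtain x a where z: "z = (x, a)" "(x, a) \<in> topspace ?T" by (cases z) auto
    have "(x, restrict a {..<length ?w}) \<in> topspace (fiber_product X M ?w)"
      using z(2) continuous_map_image_subset_topspace[OF continuous_map_fiber_product_restrict[of X M ?w "[?Q]"]]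
      by blast
    then show "proj M ?Q ((eop M f \<circ> (\<lambda>(x, a). (x, restrict a {..<length ?w}))) z)
        = proj M ?Q ((\<lambda>(x, a). a (length ?w)) z)"
      using z over by (auto simp: fiber_product_def)
  qed
  moreover have "{z \<in> topspace ?T. (eop M f \<circ> (\<lambda>(x, a). (x, restrict a {..<length ?w}))) z = (\<lambda>(x, a). a (length ?w)) z}
      = {(x, a). x \<in> topspace X \<and> a \<in> interp L (fiber M x) \<sigma>}"
    by (auto simp: topspace_fiber_product Graph_sym fiber_def)
  ultimately show ?thesis by (simp add: Graph_sym)
qed

text \<open>
  The set is the projection to the base of an open subset of the fiber product.
\<close>

lemma openin_interp_meets_sections:
  assumes M: "etale_structure L X M" and \<sigma>: "\<sigma> \<in> symbols L"
    and S: "\<And>i. i < length (sym_sorts L \<sigma>) \<Longrightarrow> openin (space_of M (sym_sorts L \<sigma> ! i)) (S i)"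
  shows "openin X {x \<in> topspace X. \<exists>a\<in>interp L (fiber M x) \<sigma>. \<forall>i<length (sym_sorts L \<sigma>). a i \<in> S i}"
proof -
  let ?w = "sym_sorts L \<sigma>"
  let ?T = "fiber_product X M ?w"
  let ?I = "{(x, a). x \<in> topspace X \<and> a \<in> interp L (fiber M x) \<sigma>}"
  let ?B = "\<lambda>i. {z \<in> topspace ?T. (\<lambda>(x, a). a i) z \<in> S i}"
  have "set ?w \<subseteq> sorts L"
    using M by (intro sym_sorts_subset[OF _ \<sigma>]) (simp add: etale_structure_def)
  then have et: "etale_space X (space_of M (?w ! i)) (proj M (?w ! i))" if "i < length ?w" for i
    using M subsetD[OF _ nth_mem[OF that], of "sorts L"] by (simp add: etale_structure_def)
  have B: "openin ?T (?B i)" if "i < length ?w" for i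
    using continuous_map_fiber_product_coordinate[OF that] S[OF that] by (rule openin_continuous_map_preimage)
  have "openin ?T (?I \<inter> (\<Inter>i<length ?w. ?B i))"
  \<comment> \<open>For the empty tuple the intersection of the coordinate conditions is \<open>UNIV\<close>, which need not be open.\<close>
  proof (cases "length ?w = 0")
    case True
    then show ?thesis using openin_interp[OF M \<sigma>] by simp
  next
    case False
    then have "openin ?T (\<Inter>i<length ?w. ?B i)" by (intro openin_INT2 B) auto
    then show ?thesis by (intro openin_Int openin_interp[OF M \<sigma>])
  qed
  moreover have "openin X (fst ` W)" if "openin ?T W" for W
  proof (rule openin_fiber_product_projection)
    show "openin ?T W" by (rule that)
  qed (rule et)
  ultimately have "openin X (fst ` (?I \<inter> (\<Inter>i<length ?w. ?B i)))" by blast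
  moreover have "fst ` (?I \<inter> (\<Inter>i<length ?w. ?B i)) =
      {x \<in> topspace X. \<exists>a\<in>interp L (fiber M x) \<sigma>. \<forall>i<length ?w. a i \<in> S i}"
  proof -
    have "(x, a) \<in> ?I \<inter> (\<Inter>i<length ?w. ?B i) \<longleftrightarrow>
        x \<in> topspace X \<and> a \<in> interp L (fiber M x) \<sigma> \<and> (\<forall>i<length ?w. a i \<in> S i)" for x a
      using subsetD[OF interp_subset, of a L "fiber M x" \<sigma>]
      by (simp add: topspace_fiber_product) blast
    then show ?thesis by (simp only: set_eq_iff image_iff Bex_def split_paired_Ex mem_Collect_eq fst_conv) blast
  qed
  ultimately show ?thesis by simp
qed

lemma countable_cover_by_open_sections:
  assumes "etale_space X A p" "second_countable A"
  obtains C where "countable C" "\<And>S. S \<in> C \<Longrightarrow> open_section X A p S" "\<Union>C = topspace A"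
proof -
  let ?O = "{S. open_section X A p S}"
  have "openin A S" if "S \<in> ?O" for S using that by (simp add: open_section_def)
  moreover have "\<Union>?O = topspace A" using assms(1) by (simp add: etale_space_def)
  ultimately have "\<exists>C. countable C \<and> C \<subseteq> ?O \<and> \<Union>C = topspace A"
    by (rule Lindelof_spaceD[OF second_countable_imp_Lindelof_space[OF assms(2)]])
  then obtain C where C: "countable C" "C \<subseteq> ?O" "\<Union>C = topspace A" by (elim exE conjE)
  show ?thesis by (rule that[OF C(1) _ C(3)]) (use C(2) in blast)
qed

text \<open>
  The cells are the singletons of the added numbers and countably many open sections covering each sort;
  the latter meet each fiber in at most one point because the projection is injective on them.
\<close>

lemma cells_exist:
  fixes M :: "('s, 'r, 'f, 'x, 'a) etale_data"
  assumes M: "etale_structure L X M" and sc: "second_countable_structure L X M"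
  obtains cell :: "nat \<Rightarrow> (nat + 's \<times> 'a) set" where
    "\<And>k P. P \<in> sorts L \<Longrightarrow> openin (space_of M P) {a. Inr (P, a) \<in> cell k}"
    "\<And>x. points L (fiber M x) \<subseteq> (\<Union>k. cell k)"
    "\<And>x u v k. \<lbrakk>u \<in> points L (fiber M x); v \<in> points L (fiber M x); u \<in> cell k; v \<in> cell k\<rbrakk> \<Longrightarrow> u = v"
proof -
  have "\<exists>C. countable C \<and> (\<forall>S\<in>C. open_section X (space_of M P) (proj M P) S) \<and> \<Union>C = topspace (space_of M P)"
    if P: "P \<in> sorts L" for P
  proof -
    have "etale_space X (space_of M P) (proj M P)" "second_countable (space_of M P)"
      using M sc P by (simp_all add: etale_structure_def second_countable_structure_def)
    then show ?thesis by (rule countable_cover_by_open_sections) blast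
  qed
  then obtain C where C: "\<And>P. P \<in> sorts L \<Longrightarrow> countable (C P)"
      "\<And>P S. P \<in> sorts L \<Longrightarrow> S \<in> C P \<Longrightarrow> open_section X (space_of M P) (proj M P) S"
      "\<And>P. P \<in> sorts L \<Longrightarrow> \<Union>(C P) = topspace (space_of M P)"
    by metis
  define K :: "(nat + 's \<times> 'a) set set" where
    "K = range (\<lambda>n. {Inl n}) \<union> (\<Union>P\<in>sorts L. (\<lambda>S. Inr ` ({P} \<times> S)) ` C P)"
  have "countable K" "K \<noteq> {}"
    using sc C(1) by (auto simp: K_def second_countable_structure_def countable_language_def)
  then have cell: "range (from_nat_into K) = K" by simp
  have K_cases: "(\<exists>n. D = {Inl n}) \<or> (\<exists>P S. P \<in> sorts L \<and> S \<in> C P \<and> D = Inr ` ({P} \<times> S))"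
    if "D \<in> K" for D
    using that unfolding K_def by blast
  show ?thesis
  proof (rule that[of "from_nat_into K"])
    fix k P assume P: "P \<in> sorts L"
    let ?D = "from_nat_into K k"
    have "?D \<in> K" using cell by blast
    from K_cases[OF this]
    consider n where "?D = {Inl n}" | Q S where "Q \<in> sorts L" "S \<in> C Q" "?D = Inr ` ({Q} \<times> S)"
      by (elim disjE exE conjE)
    then show "openin (space_of M P) {a. Inr (P, a) \<in> ?D}"
    proof cases
      case 1 then show ?thesis by simp
    next
      case 2
      have "openin (space_of M Q) S" using C(2)[OF 2(1,2)] by (simp add: open_section_def)
      moreover have "{a. Inr (P, a) \<in> ?D} = (if P = Q then S else {})" unfolding 2(3) by auto
      ultimately show ?thesis by simp
    qed
  next
    fix x show "points L (fiber M x) \<subseteq> (\<Union>k. from_nat_into K k)"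
      unfolding cell
    proof
      fix u assume "u \<in> points L (fiber M x)"
      then show "u \<in> \<Union>K"
      proof (cases rule: points_cases)
        case (1 n) then show ?thesis by (auto simp: K_def)
      next
        case (2 P a)
        then have "a \<in> \<Union>(C P)" using C(3) by (simp add: fiber_def)
        then obtain S where "S \<in> C P" "a \<in> S" by blast
        then have "Inr ` ({P} \<times> S) \<in> K" "u \<in> Inr ` ({P} \<times> S)" using 2 by (auto simp: K_def)
        then show ?thesis by (rule UnionI)
      qed
    qed
  next
    fix x u v k
    assume u: "u \<in> points L (fiber M x)" and v: "v \<in> points L (fiber M x)"
      and uD: "u \<in> from_nat_into K k" and vD: "v \<in> from_nat_into K k"
    have "from_nat_into K k \<in> K" using cell by blast
    from K_cases[OF this] consider n where "from_nat_into K k = {Inl n}"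
      | Q S where "Q \<in> sorts L" "S \<in> C Q" "from_nat_into K k = Inr ` ({Q} \<times> S)"
      by (elim disjE exE conjE)
    then show "u = v"
    proof cases
      case 1 then show ?thesis using uD vD by simp
    next
      case 2
      obtain a where a: "u = Inr (Q, a)" "a \<in> S" using uD unfolding 2(3) by blast
      obtain b where b: "v = Inr (Q, b)" "b \<in> S" using vD unfolding 2(3) by blast
      have "proj M Q a = proj M Q b" using u v a b by (simp add: fiber_def)
      then show ?thesis using open_section_inj[OF C(2)[OF 2(1,2)]] a b by (auto dest: inj_onD)
    qed
  qed
qed

text \<open>
  The name of a number does not depend on the base point.  For the other symbols, the part of a cell in
  a given sort is open, so this is an instance of \<open>openin_interp_meets_sections\<close>.
\<close>

lemma openin_holds_meets_cells:
  fixes M :: "('s, 'r, 'f, 'x, 'a) etale_data"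
  assumes M: "etale_structure L X M" and \<sigma>: "\<sigma> \<in> symbols L"
    and C: "\<And>i P. P \<in> sorts L \<Longrightarrow> openin (space_of M P) {a. Inr (P, a) \<in> C i}"
  shows "openin X {x \<in> topspace X. \<exists>v\<in>{..<sym_arity L \<sigma>} \<rightarrow>\<^sub>E points L (fiber M x).
    holds L (fiber M x) \<sigma> v \<and> (\<forall>i<sym_arity L \<sigma>. v i \<in> C i)}" (is "openin X ?R")
proof (cases "\<exists>n. \<sigma> = Nat_sym n")
  case True
  then obtain n where n: "\<sigma> = Nat_sym n" by blast
  have "?R = (if Inl n \<in> C 0 then topspace X else {})"
  proof (cases "Inl n \<in> C 0")
    case True
    have "\<exists>v\<in>{..<1} \<rightarrow>\<^sub>E points L (fiber M x). v 0 = Inl n \<and> (\<forall>i<1. v i \<in> C i)" for x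
      using True by (intro bexI[of _ "\<lambda>i\<in>{..<1}. Inl n"]) auto
    then show ?thesis using True by (simp add: n)
  next
    case False then show ?thesis by (auto simp: n)
  qed
  then show ?thesis by simp
next
  case False
  then have n: "\<And>n. \<sigma> \<noteq> Nat_sym n" by blast
  let ?w = "sym_sorts L \<sigma>"
  let ?S = "\<lambda>i. {a. Inr (?w ! i, a) \<in> C i}"
  have w: "set ?w \<subseteq> sorts L" 
    using M by (intro sym_sorts_subset[OF _ \<sigma>]) (simp add: etale_structure_def)
  have "openin X {x \<in> topspace X. \<exists>a\<in>interp L (fiber M x) \<sigma>. \<forall>i<length ?w. a i \<in> ?S i}"
    by (intro openin_interp_meets_sections[OF M \<sigma>] C subsetD[OF w] nth_mem)
  moreover have "(\<exists>v\<in>{..<sym_arity L \<sigma>} \<rightarrow>\<^sub>E points L (fiber M x). holds L (fiber M x) \<sigma> v \<and> (\<forall>i<sym_arity L \<sigma>. v i \<in> C i))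
      \<longleftrightarrow> (\<exists>a\<in>interp L (fiber M x) \<sigma>. \<forall>i<length ?w. a i \<in> ?S i)" (is "?l \<longleftrightarrow> ?r") for x
  proof
    assume ?l
    then obtain a where a: "a \<in> interp L (fiber M x) \<sigma>" "\<forall>i<length ?w. tagged ?w a i \<in> C i"
      unfolding holds_other[OF n] by blast
    then show ?r by (intro bexI[of _ a]) (simp_all add: tagged_def)
  next
    assume ?r
    then obtain a where a: "a \<in> interp L (fiber M x) \<sigma>" "\<forall>i<length ?w. a i \<in> ?S i" by blast
    have ta: "a \<in> tuples (fiber M x) ?w" using a(1) interp_subset by blast
    show ?l
      unfolding holds_other[OF n]
      by (intro bexI[of _ "tagged ?w a"] conjI imageI a(1) tagged_in_points[OF ta w])
        (use a(2) in \<open>simp add: tagged_def\<close>)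
  qed
  ultimately show ?thesis by simp
qed

text \<open>
  An added number in both cells is a common point over every \<open>x\<close>.  Otherwise the common
  points lie in the sorts, and the set in question is a union of images of open sets under
  the projections, which are open maps.
\<close>

lemma openin_points_meet_cells:
  fixes M :: "('s, 'r, 'f, 'x, 'a) etale_data"
  assumes M: "etale_structure L X M"
    and C: "\<And>P. P \<in> sorts L \<Longrightarrow> openin (space_of M P) {a. Inr (P, a) \<in> C}"
    and D: "\<And>P. P \<in> sorts L \<Longrightarrow> openin (space_of M P) {a. Inr (P, a) \<in> D}"
  shows "openin X {x \<in> topspace X. points L (fiber M x) \<inter> C \<inter> D \<noteq> {}}" (is "openin X ?R")
proof (cases "\<exists>n. Inl n \<in> C \<inter> D")
  case True
  then obtain n where "Inl n \<in> C \<inter> D" ..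
  moreover have "Inl n \<in> points L (fiber M x)" for x by simp
  ultimately have "?R = topspace X" by blast
  then show ?thesis by simp
next
  case False
  let ?S = "\<lambda>P. {a. Inr (P, a) \<in> C} \<inter> {a. Inr (P, a) \<in> D}"
  have et: "etale_space X (space_of M P) (proj M P)" if "P \<in> sorts L" for P
    using M that by (simp add: etale_structure_def)
  have open_S: "openin (space_of M P) (?S P)" if "P \<in> sorts L" for P
    by (intro openin_Int C D that)
  have "openin X (\<Union>P\<in>sorts L. proj M P ` ?S P)"
    using etale_space_openin_image[OF et open_S] by blast
  moreover have "?R = (\<Union>P\<in>sorts L. proj M P ` ?S P)"
  proof (intro equalityI subsetI)
    fix x assume "x \<in> ?R"
    then obtain u where u: "u \<in> points L (fiber M x)" "u \<in> C" "u \<in> D" by blast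
    then show "x \<in> (\<Union>P\<in>sorts L. proj M P ` ?S P)"
      using False by (cases rule: points_cases) (auto simp: fiber_def)
  next
    fix x assume "x \<in> (\<Union>P\<in>sorts L. proj M P ` ?S P)"
    then obtain P a where P: "P \<in> sorts L" and a: "a \<in> ?S P" "x = proj M P a" by blast
    have "a \<in> topspace (space_of M P)" using openin_subset[OF open_S[OF P]] a(1) by blast
    then have "x \<in> topspace X" "Inr (P, a) \<in> points L (fiber M x)"
      using et[OF P] P a(2) by (auto simp: fiber_def etale_space_def continuous_map_def)
    then show "x \<in> ?R" using a(1) by blast
  qed
  ultimately show ?thesis by simp
qed

lemma openin_iso_topology:
  shows "openin X U \<Longrightarrow> openin (iso_topology L X M) {(x, y, h) \<in> iso_morphisms L X M. x \<in> U}"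
    and "openin X U \<Longrightarrow> openin (iso_topology L X M) {(x, y, h) \<in> iso_morphisms L X M. y \<in> U}"
    and "\<lbrakk>P \<in> sorts L; openin (space_of M P) S; openin (space_of M P) T\<rbrakk> \<Longrightarrow>
      openin (iso_topology L X M) {(x, y, h) \<in> iso_morphisms L X M.
        h P ` (S \<inter> carr (fiber M x) P) \<inter> (T \<inter> carr (fiber M y) P) \<noteq> {}}"
  unfolding iso_topology_def
  by (rule topology_generated_by_Basis, rule UnI1, rule UnI1, rule CollectI, intro exI conjI, rule refl, assumption)
    (rule topology_generated_by_Basis, rule UnI1, rule UnI2, rule CollectI, intro exI conjI, rule refl, assumption,
     rule topology_generated_by_Basis, rule UnI2, rule CollectI, intro exI conjI, rule refl, assumption+)

lemma continuous_map_iso_source: "continuous_map (iso_topology L X M) X (\<lambda>(x, y, h). x)"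
  and continuous_map_iso_target: "continuous_map (iso_topology L X M) X (\<lambda>(x, y, h). y)"
proof -
  have eq: "{m \<in> iso_morphisms L X M. (\<lambda>(x, y, h). x) m \<in> U} = {(x, y, h) \<in> iso_morphisms L X M. x \<in> U}"
    "{m \<in> iso_morphisms L X M. (\<lambda>(x, y, h). y) m \<in> U} = {(x, y, h) \<in> iso_morphisms L X M. y \<in> U}" for U
    by auto
  show "continuous_map (iso_topology L X M) X (\<lambda>(x, y, h). x)"
    unfolding continuous_map_def topspace_iso_topology eq
    by (intro conjI allI impI openin_iso_topology(1)) (auto simp: iso_morphisms_iff)
  show "continuous_map (iso_topology L X M) X (\<lambda>(x, y, h). y)"
    unfolding continuous_map_def topspace_iso_topology eq
    by (intro conjI allI impI openin_iso_topology(2)) (auto simp: iso_morphisms_iff)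
qed

text \<open>
  On the sorts this is a union of members of the defining subbase of the topology on isomorphisms.
\<close>

lemma openin_lift_maps_cell_to_cell:
  fixes M :: "('s, 'r, 'f, 'x, 'a) etale_data"
  assumes C: "\<And>P. P \<in> sorts L \<Longrightarrow> openin (space_of M P) {a. Inr (P, a) \<in> C}"
    and D: "\<And>P. P \<in> sorts L \<Longrightarrow> openin (space_of M P) {a. Inr (P, a) \<in> D}"
  shows "openin (iso_topology L X M)
    {(x, y, h) \<in> iso_morphisms L X M. \<exists>u\<in>points L (fiber M x) \<inter> C. lift h u \<in> D}" (is "openin _ ?R")
proof (cases "\<exists>n. Inl n \<in> C \<inter> D")
  case True
  then obtain n where n: "Inl n \<in> C" "Inl n \<in> D" by blast
  have "\<exists>u\<in>points L (fiber M x) \<inter> C. lift h u \<in> D" for x and h :: "'s \<Rightarrow> 'a \<Rightarrow> 'a"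
    using n by (intro bexI[of _ "Inl n"]) auto
  then have "?R = topspace (iso_topology L X M)" by (auto simp: topspace_iso_topology)
  then show ?thesis by simp
next
  case False
  let ?B = "\<lambda>P. {(x, y, h) \<in> iso_morphisms L X M.
    h P ` ({a. Inr (P, a) \<in> C} \<inter> carr (fiber M x) P) \<inter> ({a. Inr (P, a) \<in> D} \<inter> carr (fiber M y) P) \<noteq> {}}"
  have "openin (iso_topology L X M) (?B P)" if P: "P \<in> sorts L" for P
    by (rule openin_iso_topology(3)[OF P C[OF P] D[OF P]])
  then have "openin (iso_topology L X M) (\<Union>P\<in>sorts L. ?B P)" by blast
  moreover have "?R = (\<Union>P\<in>sorts L. ?B P)"
  proof -
    have "(\<exists>u\<in>points L (fiber M x) \<inter> C. lift h u \<in> D) \<longleftrightarrow> (\<exists>P\<in>sorts L.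
        h P ` ({a. Inr (P, a) \<in> C} \<inter> carr (fiber M x) P) \<inter> ({a. Inr (P, a) \<in> D} \<inter> carr (fiber M y) P) \<noteq> {})"
      (is "?l \<longleftrightarrow> ?r") if m: "(x, y, h) \<in> iso_morphisms L X M" for x y h
    proof
      assume ?l
      then obtain u where u: "u \<in> points L (fiber M x)" "u \<in> C" "lift h u \<in> D" by blast
      show ?r
        using u(1)
      proof (cases rule: points_cases)
        case (1 n) then show ?thesis using u False by auto
      next
        case (2 P a)
        then have "h P a \<in> carr (fiber M y) P"
          using m by (auto simp: iso_morphisms_iff structure_iso_def bij_betw_def)
        then show ?thesis using 2 u by auto
      qed
    next
      assume ?r
      then obtain P a where "P \<in> sorts L" "Inr (P, a) \<in> C" "a \<in> carr (fiber M x) P" "Inr (P, h P a) \<in> D"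
        by blast
      then show ?l by (intro bexI[of _ "Inr (P, a)"]) auto
    qed
    note meet = this
    show ?thesis
    proof (rule set_eqI)
      fix m :: "'x \<times> 'x \<times> ('s \<Rightarrow> 'a \<Rightarrow> 'a)"
      obtain x y h where m: "m = (x, y, h)" by (rule prod_cases3)
      show "m \<in> ?R \<longleftrightarrow> m \<in> (\<Union>P\<in>sorts L. ?B P)"
      proof (cases "(x, y, h) \<in> iso_morphisms L X M")
        case True
        then show ?thesis using meet[OF True] unfolding m by simp
      next
        case False
        then show ?thesis unfolding m by simp
      qed
    qed
  qed
  ultimately show ?thesis by simp
qed

section \<open>The functor\<close>

text \<open>
  An etale structure over \<open>X\<close> together with an indexed family of cells as produced by \<open>cells_exist\<close>.
\<close>

locale etale_cells =
  fixes L :: "('s, 'r, 'f) language" and X :: "'x topology"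
    and M :: "('s, 'r, 'f, 'x, 'a) etale_data"
    and cell :: "nat \<Rightarrow> (nat + 's \<times> 'a) set"
  assumes M: "etale_structure L X M"
    and countable_L: "countable_language L"
    and cell_open: "P \<in> sorts L \<Longrightarrow> openin (space_of M P) {a. Inr (P, a) \<in> cell k}"
    and cell_cover: "points L (fiber M x) \<subseteq> (\<Union>k. cell k)"
    and cell_inj: "\<lbrakk>u \<in> points L (fiber M x); v \<in> points L (fiber M x); u \<in> cell k; v \<in> cell k\<rbrakk> \<Longrightarrow> u = v"

sublocale etale_cells \<subseteq> cell_family "borel_of X" "\<lambda>x. points L (fiber M x)" cell
proof
  fix x
  show "infinite (points L (fiber M x))"
    unfolding points_def by (simp add: finite_Un range_inj_infinite)
next
  fix j k
  show "{x \<in> space (borel_of X). points L (fiber M x) \<inter> cell j \<inter> cell k \<noteq> {}} \<in> sets (borel_of X)"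
    unfolding space_borel_of by (intro openin_in_borel_of openin_points_meet_cells[OF M] cell_open)
qed (rule cell_cover, rule cell_inj)

context etale_cells
begin

lemma language_L: "language L" using M by (simp add: etale_structure_def)

lemmas op_closed = fiber_op[OF M]

text \<open>
  The symbols form a countable nonempty set, so the language can be taken to be all natural numbers; a
  symbol may be listed more than once, which does not affect isomorphisms.
\<close>

definition nth_symbol :: "nat \<Rightarrow> ('s, 'r, 'f) symbol" where
  "nth_symbol = from_nat_into (symbols L)"

definition ar :: "nat \<Rightarrow> nat" where
  "ar l = sym_arity L (nth_symbol l)"

text \<open>
  The object part of the functor.
\<close>

definition code :: "'x \<Rightarrow> nat \<Rightarrow> (nat \<Rightarrow> nat) \<Rightarrow> bool" where
  "code x = transport ar (\<lambda>l. holds L (fiber M x) (nth_symbol l)) (point x)"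

text \<open>
  The group component of the functor on morphisms: the conjugate of \<open>lift h\<close> by the enumerations of the
  points over source and target.
\<close>

definition perm :: "'x \<times> 'x \<times> ('s \<Rightarrow> 'a \<Rightarrow> 'a) \<Rightarrow> nat \<Rightarrow> nat" where
  "perm = (\<lambda>(x, y, h). inv (point y) \<circ> lift h \<circ> point x)"

lemma code_in: "code x \<in> topspace (Mod_nat UNIV ar)"
  by (simp add: code_def transport_in)

lemma range_sym: "range nth_symbol = symbols L"
proof -
  have "countable (symbols L)"
    using countable_L unfolding symbols_def countable_language_def by auto
  moreover have "symbols L \<noteq> {}" by (auto simp: symbols_def)
  ultimately show ?thesis by (simp add: nth_symbol_def)
qed

lemma inv_point: "x \<in> topspace X \<Longrightarrow> inv (point x) (point x n) = n"
  using bij_point[of x] by (simp add: bij_betw_def)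

lemma point_inv: "x \<in> topspace X \<Longrightarrow> u \<in> points L (fiber M x) \<Longrightarrow> point x (inv (point x) u) = u"
  using bij_point[of x] by (simp add: bij_betw_def f_inv_into_f)

lemma pushforward_code_iff:
  assumes x: "x \<in> topspace X" and g: "bij g"
  shows "pushforward UNIV ar g (code x) = code y \<longleftrightarrow>
    preserves_symbols L (fiber M x) (fiber M y) (\<lambda>u. point y (g (inv (point x) u)))"
proof -
  have e: "bij_betw (point x) UNIV (points L (fiber M x))" using bij_point x by simp
  show ?thesis
    unfolding code_def pushforward_transport_iff[OF e g] preserves_symbols_def range_sym[symmetric] ar_def
    by simp
qed

lemma iso_morphismsD:
  assumes "(x, y, h) \<in> iso_morphisms L X M"
  shows "x \<in> topspace X" "y \<in> topspace X" "structure_iso L (fiber M x) (fiber M y) h"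
    "\<And>P. P \<in> sorts L \<Longrightarrow> bij_betw (h P) (carr (fiber M x) P) (carr (fiber M y) P)"
    "bij_betw (lift h) (points L (fiber M x)) (points L (fiber M y))"
    "h \<in> (\<Pi>\<^sub>E P\<in>sorts L. extensional (carr (fiber M x) P))"
proof -
  show *: "x \<in> topspace X" "y \<in> topspace X" "structure_iso L (fiber M x) (fiber M y) h"
    "h \<in> (\<Pi>\<^sub>E P\<in>sorts L. extensional (carr (fiber M x) P))"
    using assms by (simp_all add: iso_morphisms_iff)
  show bij: "bij_betw (h P) (carr (fiber M x) P) (carr (fiber M y) P)" if "P \<in> sorts L" for P
    using *(3) that by (simp add: structure_iso_def)
  show "bij_betw (lift h) (points L (fiber M x)) (points L (fiber M y))"
    by (rule bij_betw_lift) (rule bij)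
qed

lemma lift_in_points:
  "(x, y, h) \<in> iso_morphisms L X M \<Longrightarrow> u \<in> points L (fiber M x) \<Longrightarrow> lift h u \<in> points L (fiber M y)"
  using bij_betw_apply[OF iso_morphismsD(5)] .

lemma point_perm:
  assumes "(x, y, h) \<in> iso_morphisms L X M"
  shows "point y (perm (x, y, h) n) = lift h (point x n)"
  using iso_morphismsD(1,2)[OF assms] lift_in_points[OF assms] by (simp add: perm_def point_inv)

lemma bij_perm:
  assumes m: "(x, y, h) \<in> iso_morphisms L X M"
  shows "bij (perm (x, y, h))"
proof -
  have x: "bij_betw (point x) UNIV (points L (fiber M x))"
    and y: "bij_betw (point y) UNIV (points L (fiber M y))"
    using iso_morphismsD(1,2)[OF m] bij_point by simp_all
  show ?thesis
    using bij_betw_trans[OF bij_betw_trans[OF x iso_morphismsD(5)[OF m]] bij_betw_inv_into[OF y]]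
    by (simp add: perm_def comp_assoc)
qed

lemma pushforward_perm:
  assumes m: "(x, y, h) \<in> iso_morphisms L X M"
  shows "pushforward UNIV ar (perm (x, y, h)) (code x) = code y"
proof -
  note x = iso_morphismsD(1)[OF m]
  have "point y (perm (x, y, h) (inv (point x) u)) = lift h u" if "u \<in> points L (fiber M x)" for u
    using point_inv[OF x that] by (simp add: point_perm[OF m])
  then show ?thesis
    using preserves_symbols_lift[OF language_L op_closed[OF x] iso_morphismsD(4)[OF m]] iso_morphismsD(3)[OF m]
    by (simp add: pushforward_code_iff[OF x bij_perm[OF m]] cong: preserves_symbols_cong)
qed

lemma perm_id:
  assumes x: "x \<in> topspace X"
  shows "perm (x, x, \<lambda>P\<in>sorts L. \<lambda>a\<in>carr (fiber M x) P. a) = id"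
proof -
  have "lift (\<lambda>P\<in>sorts L. \<lambda>a\<in>carr (fiber M x) P. a) u = u" if "u \<in> points L (fiber M x)" for u
    using that by (cases rule: points_cases) simp_all
  then show ?thesis using x by (simp add: perm_def fun_eq_iff inv_point)
qed

text \<open>
  The enumerations of the points over \<open>y\<close> cancel in the composite of the two conjugates.
\<close>

lemma perm_comp:
  assumes h: "(x, y, h) \<in> iso_morphisms L X M" and k: "(y, z, k) \<in> iso_morphisms L X M"
  shows "perm (x, z, \<lambda>P\<in>sorts L. \<lambda>a\<in>carr (fiber M x) P. k P (h P a)) = perm (y, z, k) \<circ> perm (x, y, h)"
proof
  fix n
  let ?kh = "\<lambda>P\<in>sorts L. \<lambda>a\<in>carr (fiber M x) P. k P (h P a)"
  have "lift ?kh u = lift k (lift h u)" if "u \<in> points L (fiber M x)" for u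
    using that by (cases rule: points_cases) simp_all
  then have "lift ?kh (point x n) = lift k (point y (perm (x, y, h) n))"
    using iso_morphismsD(1)[OF h] by (simp add: point_perm[OF h])
  then show "perm (x, z, ?kh) n = (perm (y, z, k) \<circ> perm (x, y, h)) n"
    by (simp add: perm_def)
qed

text \<open>
  A permutation carrying one coded structure to another conjugates back to a symbol preserving
  bijection of points, and such a bijection comes from an isomorphism of the fibers.
\<close>

lemma perm_full:
  assumes x: "x \<in> topspace X" and y: "y \<in> topspace X"
    and g: "bij g" "pushforward UNIV ar g (code x) = code y"
  obtains h where "(x, y, h) \<in> iso_morphisms L X M" "perm (x, y, h) = g"
proof -
  let ?\<phi> = "\<lambda>u. point y (g (inv (point x) u))"
  have ex: "bij_betw (point x) UNIV (points L (fiber M x))"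
    and ey: "bij_betw (point y) UNIV (points L (fiber M y))"
    using x y bij_point by simp_all
  have bij: "bij_betw ?\<phi> (points L (fiber M x)) (points L (fiber M y))"
    using bij_betw_trans[OF bij_betw_trans[OF bij_betw_inv_into[OF ex] g(1)] ey] by (simp add: comp_def)
  have pres: "preserves_symbols L (fiber M x) (fiber M y) ?\<phi>"
    using g pushforward_code_iff[OF x] by simp
  from preserves_symbols_imp_lift[OF bij pres] obtain h where
      h_ext: "h \<in> (\<Pi>\<^sub>E P\<in>sorts L. extensional (carr (fiber M x) P))"
      and h_bij: "\<forall>P\<in>sorts L. bij_betw (h P) (carr (fiber M x) P) (carr (fiber M y) P)"
      and h_lift: "\<forall>u\<in>points L (fiber M x). ?\<phi> u = lift h u"
    by (elim bexE conjE)
  note h = h_ext bspec[OF h_bij] bspec[OF h_lift]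
  have "structure_iso L (fiber M x) (fiber M y) h"
    using pres preserves_symbols_lift[OF language_L op_closed[OF x] h(2)]
      preserves_symbols_cong[of L "fiber M x" ?\<phi> "lift h" "fiber M y"] h(3) by simp
  then have "(x, y, h) \<in> iso_morphisms L X M" using x y h(1) by (simp add: iso_morphisms_iff)
  moreover have "perm (x, y, h) n = g n" for n
    using x y by (simp add: perm_def inv_point flip: h(3))
  then have "perm (x, y, h) = g" by (rule ext)
  ultimately show ?thesis by (rule that)
qed

text \<open>
  The permutation determines \<open>lift h\<close> on all points over the source, hence \<open>h\<close> on each sort; outside the
  sorts and the fiber morphisms are normalised.
\<close>

lemma perm_faithful:
  assumes h: "(x, y, h) \<in> iso_morphisms L X M" and k: "(x, y, k) \<in> iso_morphisms L X M"
    and eq: "perm (x, y, h) = perm (x, y, k)"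
  shows "h = k"
proof -
  note x = iso_morphismsD(1)[OF h]
  have "lift h u = lift k u" if "u \<in> points L (fiber M x)" for u
    using point_perm[OF h, of "inv (point x) u"] point_perm[OF k, of "inv (point x) u"] eq
    by (simp add: point_inv[OF x that])
  then have "h P a = k P a" if "P \<in> sorts L" "a \<in> carr (fiber M x) P" for P a
    using that by (metis lift_simps(2) points_simps(2) old.sum.inject(2) prod.inject)
  moreover have "h P \<in> extensional (carr (fiber M x) P)" "k P \<in> extensional (carr (fiber M x) P)" if "P \<in> sorts L" for P
    using iso_morphismsD(6)[OF h] iso_morphismsD(6)[OF k] that by (auto simp: PiE_iff)
  ultimately have "h P = k P" if "P \<in> sorts L" for P
    using that by (intro extensionalityI[of _ "carr (fiber M x) P"]) auto
  then show ?thesis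
    using iso_morphismsD(6)[OF h] iso_morphismsD(6)[OF k] by (intro PiE_ext) auto
qed

lemma sets_code:
  assumes t: "t \<in> nat_tuples (ar l)"
  shows "{x \<in> topspace X. code x l t} \<in> sets (borel_of X)"
proof -
  have nth_symbol: "nth_symbol l \<in> symbols L" using range_sym by blast
  have "openin X {x \<in> topspace X. \<exists>v\<in>{..<ar l} \<rightarrow>\<^sub>E points L (fiber M x).
      holds L (fiber M x) (nth_symbol l) v \<and> (\<forall>i<ar l. v i \<in> cell (c i))}" for c
    unfolding ar_def
    by (rule openin_holds_meets_cells[OF M nth_symbol, where C = "\<lambda>i. cell (c i)"]) (rule cell_open)
  note openin_in_borel_of[OF this]
  from sets_relation_at_points[where Q = "\<lambda>x. holds L (fiber M x) (nth_symbol l)", unfolded space_borel_of, OF this]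
  show ?thesis using t by (simp add: code_def transport_def)
qed

lemma measurable_code: "code \<in> measurable (borel_of X) (borel_of (Mod_nat UNIV ar))"
  by (rule measurable_Mod_nat) (simp_all add: code_in sets_code)

lemma sets_perm: "{m \<in> iso_morphisms L X M. perm m n = k} \<in> sets (borel_of (iso_topology L X M))"
proof -
  let ?Q = "borel_of (iso_topology L X M)"
  let ?s = "\<lambda>(x, y, h). x" and ?t = "\<lambda>(x, y, h). y" and ?\<phi> = "\<lambda>(x, y, h). lift h"
  have Q: "space ?Q = iso_morphisms L X M" by (simp add: topspace_iso_topology)
  have meas: "{m \<in> space ?Q. ?\<phi> m (point (?s m) n) = point (?t m) k} \<in> sets ?Q"
  proof (rule sets_map_at_points)
    show "?s \<in> measurable ?Q (borel_of X)" "?t \<in> measurable ?Q (borel_of X)"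
      by (intro measurable_borel_of_continuous continuous_map_iso_source continuous_map_iso_target)+
    show "?\<phi> m u \<in> points L (fiber M (?t m))" if "m \<in> space ?Q" "u \<in> points L (fiber M (?s m))" for m u
      using that lift_in_points unfolding Q by (cases m) auto
    fix i j
    have "{m \<in> space ?Q. \<exists>u\<in>points L (fiber M (?s m)) \<inter> cell i. ?\<phi> m u \<in> cell j} =
      {(x, y, h) \<in> iso_morphisms L X M. \<exists>u\<in>points L (fiber M x) \<inter> cell i. lift h u \<in> cell j}"
      unfolding Q by auto
    then show "{m \<in> space ?Q. \<exists>u\<in>points L (fiber M (?s m)) \<inter> cell i. ?\<phi> m u \<in> cell j} \<in> sets ?Q"
      using openin_in_borel_of[OF openin_lift_maps_cell_to_cell[OF cell_open cell_open]] by simp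
  qed
  have eq: "?\<phi> m (point (?s m) n) = point (?t m) k \<longleftrightarrow> perm m n = k" if "m \<in> iso_morphisms L X M" for m
  proof -
    obtain x y h where m: "m = (x, y, h)" by (rule prod_cases3)
    have "inj (point y)" using bij_point[of y] iso_morphismsD(2) that m by (auto simp: bij_betw_def)
    then show ?thesis using point_perm[of x y h n] that by (auto simp: m inj_eq dest: sym)
  qed
  have "{m \<in> iso_morphisms L X M. ?\<phi> m (point (?s m) n) = point (?t m) k} = {m \<in> iso_morphisms L X M. perm m n = k}"
    by (intro Collect_cong conj_cong refl eq)
  with meas show ?thesis unfolding Q by (simp only:)
qed

end

theorem theorem1p8:
  fixes X :: "'x topology"
    and L0 :: "('s, 'r, 'f) language"
    and M :: "('s, 'r, 'f, 'x, 'a) etale_data"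
  assumes "quasi_polish X"
    and "etale_structure L0 X M"
    and "second_countable_structure L0 X M"
  shows "\<exists>(L :: nat set) (ar :: nat \<Rightarrow> nat) F0 F1.
           countable L \<and>
           borel_functor (iso_groupoid L0 X M) (action_groupoid L ar) F0 F1 \<and>
           full_functor (iso_groupoid L0 X M) (action_groupoid L ar) F0 F1 \<and>
           faithful_functor (iso_groupoid L0 X M) (action_groupoid L ar) F0 F1"
proof -
  obtain cell :: "nat \<Rightarrow> (nat + 's \<times> 'a) set" where cell:
    "\<And>k P. P \<in> sorts L0 \<Longrightarrow> openin (space_of M P) {a. Inr (P, a) \<in> cell k}"
    "\<And>x. points L0 (fiber M x) \<subseteq> (\<Union>k. cell k)"
    "\<And>x u v k. \<lbrakk>u \<in> points L0 (fiber M x); v \<in> points L0 (fiber M x); u \<in> cell k; v \<in> cell k\<rbrakk> \<Longrightarrow> u = v"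
    using cells_exist[OF assms(2,3)] by metis
  interpret etale_cells L0 X M cell
    using assms(2,3) cell by unfold_locales (simp_all add: second_countable_structure_def)
  let ?G = "iso_groupoid L0 X M" and ?H = "action_groupoid UNIV ar"
  let ?F1 = "\<lambda>m. (perm m, code (fst m))"
  have G: "arrows ?G = iso_morphisms L0 X M" "objects ?G = topspace X"
    "\<And>x y h. src ?G (x, y, h) = x" "\<And>x y h. tgt ?G (x, y, h) = y"
    by (simp_all add: iso_groupoid_def topspace_iso_topology)
  have hom: "m \<in> hom_set ?G x y \<longleftrightarrow> (\<exists>h. m = (x, y, h) \<and> (x, y, h) \<in> iso_morphisms L0 X M)" for m x y
    by (cases m) (auto simp: hom_set_def G)
  have "borel_functor ?G ?H code ?F1"
    unfolding borel_functor_def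
  proof (intro conjI ballI impI)
    show "code \<in> measurable (borel_of (Obj ?G)) (borel_of (Obj ?H))"
      using measurable_code by (simp add: iso_groupoid_def action_groupoid_def)
    have Q: "space (borel_of (iso_topology L0 X M)) = iso_morphisms L0 X M" by (simp add: topspace_iso_topology)
    have "?F1 \<in> measurable (borel_of (iso_topology L0 X M)) (borel_of (prod_topology S_infinity (Mod_nat UNIV ar)))"
    proof (rule measurable_action_morphism; (unfold Q)?)
      fix R t assume t: "t \<in> nat_tuples (ar R)"
      have src: "(\<lambda>(x, y, h). x) \<in> measurable (borel_of (iso_topology L0 X M)) (borel_of X)"
        by (intro measurable_borel_of_continuous continuous_map_iso_source)
      have "(\<lambda>(x, y, h). x) -` {x \<in> topspace X. code x R t} \<inter> iso_morphisms L0 X M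
          = {m \<in> iso_morphisms L0 X M. code (fst m) R t}"
        by (auto simp: iso_morphisms_iff)
      then show "{m \<in> iso_morphisms L0 X M. code (fst m) R t} \<in> sets (borel_of (iso_topology L0 X M))"
        using measurable_sets[OF src sets_code[OF t]] unfolding Q by simp
    qed (use bij_perm code_in sets_perm in auto)
    then show "?F1 \<in> measurable (borel_of (Mor ?G)) (borel_of (Mor ?H))"
      by (simp add: iso_groupoid_def action_groupoid_def)
  next
    fix m assume "m \<in> arrows ?G"
    then obtain x y h where m: "m = (x, y, h)" "(x, y, h) \<in> iso_morphisms L0 X M" by (cases m) (auto simp: G)
    show "src ?H (?F1 m) = code (src ?G m)" by (simp add: m(1) G action_groupoid_def)
    show "tgt ?H (?F1 m) = code (tgt ?G m)"
      using pushforward_perm[OF m(2)] by (simp add: m(1) G action_groupoid_def)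
  next
    fix x assume "x \<in> objects ?G"
    then show "?F1 (ident ?G x) = ident ?H (code x)"
      using perm_id by (simp add: iso_groupoid_def action_groupoid_def)
  next
    fix f g assume fg: "f \<in> arrows ?G" "g \<in> arrows ?G" "src ?G g = tgt ?G f"
    obtain x y h where f: "f = (x, y, h)" by (rule prod_cases3)
    obtain y' z k where g: "g = (y', z, k)" by (rule prod_cases3)
    have "(x, y, h) \<in> iso_morphisms L0 X M" "(y, z, k) \<in> iso_morphisms L0 X M" "y' = y"
      using fg by (auto simp: f g G)
    then show "?F1 (mcomp ?G g f) = mcomp ?H (?F1 g) (?F1 f)"
      using perm_comp by (simp add: f g iso_groupoid_def action_groupoid_def)
  qed
  moreover have "full_functor ?G ?H code ?F1"
    unfolding full_functor_def
  proof (intro ballI equalityI subsetI)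
    fix x y n assume xy: "x \<in> objects ?G" "y \<in> objects ?G"
    assume "n \<in> ?F1 ` hom_set ?G x y"
    then obtain h where n: "n = (perm (x, y, h), code x)" and h: "(x, y, h) \<in> iso_morphisms L0 X M"
      by (auto simp: hom)
    show "n \<in> hom_set ?H (code x) (code y)"
      using pushforward_perm[OF h] bij_perm[OF h] code_in
      by (simp add: n hom_set_def action_groupoid_def topspace_S_infinity)
  next
    fix x y n assume xy: "x \<in> objects ?G" "y \<in> objects ?G"
    assume "n \<in> hom_set ?H (code x) (code y)"
    then obtain g where n: "n = (g, code x)" and g: "bij g" "pushforward UNIV ar g (code x) = code y"
      by (cases n) (auto simp: hom_set_def action_groupoid_def topspace_S_infinity)
    obtain h where h: "(x, y, h) \<in> iso_morphisms L0 X M" "perm (x, y, h) = g"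
      using perm_full[OF _ _ g] xy unfolding G by blast
    have "n = ?F1 (x, y, h)" by (simp add: n h(2))
    moreover have "(x, y, h) \<in> hom_set ?G x y" using h(1) hom by blast
    ultimately show "n \<in> ?F1 ` hom_set ?G x y" by (rule image_eqI)
  qed
  moreover have "faithful_functor ?G ?H code ?F1"
    unfolding faithful_functor_def
  proof (intro ballI inj_onI)
    fix x y m m' assume "m \<in> hom_set ?G x y" "m' \<in> hom_set ?G x y" "?F1 m = ?F1 m'"
    then show "m = m'" using perm_faithful unfolding hom by blast
  qed
  ultimately show ?thesis
    by (intro exI[of _ "UNIV :: nat set"] exI[of _ ar] exI[of _ code] exI[of _ ?F1] conjI) simp_all
qed

end
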